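(* Let $X,Y$ be real-valued random variables on an atomless probability space $(\Omega,\mathcal F,\mathbb P)$ such that $X\le_{\rm cx}Y$. There exists a random variable $X'$ on $(\Omega,\mathcal F,\mathbb P)$ that has the same law as $X$ and satisfies $X'=\mathbb E[Y|X']$ almost surely.
   Context: For random variables, $X\le_{\rm cx}Y$ means that the laws of $X$ and $Y$ are Borel probability measures on $\mathbb R$ with finite first moment which are in convex order: $\mathbb E[\phi(X)]\le\mathbb E[\phi(Y)]$ for every convex $\phi:\mathbb R\to\mathbb R$. *)

theory Defs
  imports "HOL-Probability.Probability"
begin

definition atomless :: "'a measure \<Rightarrow> bool" where
  "atomless M \<longleftrightarrow>
     (\<forall>A\<in>sets M. emeasure M A > 0 \<longrightarrow>
        (\<exists>B\<in>sets M. B \<subseteq> A \<and> 0 < emeasure M B \<and> emeasure M B < emeasure M A))"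

text \<open>
  A convex function of an integrable random variable has an integrable negative part, but its
  expectation may be infinite. The Bochner integral is 0 on non-integrable functions, so the
  expectation is taken in \<^typ>\<open>ereal\<close>, as the integral of the positive part minus that of the
  negative part (\<^const>\<open>ennreal\<close> truncates negative numbers to 0).
\<close>

definition ext_integral :: "'a measure \<Rightarrow> ('a \<Rightarrow> real) \<Rightarrow> ereal" where
  "ext_integral M f =
     enn2ereal (\<integral>\<^sup>+x. ennreal (f x) \<partial>M) - enn2ereal (\<integral>\<^sup>+x. ennreal (- f x) \<partial>M)"

lemma ext_integral_eq_integral:
  assumes "integrable M f"
  shows "ext_integral M f = ereal (integral\<^sup>L M f)"
proof -
  have "(\<integral>\<^sup>+x. ennreal (f x) \<partial>M) < \<infinity>" "(\<integral>\<^sup>+x. ennreal (- f x) \<partial>M) < \<infinity>"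
    using assms by (auto simp: real_integrable_def less_top)
  then show ?thesis
    unfolding ext_integral_def real_lebesgue_integral_def[OF assms]
    by (cases "\<integral>\<^sup>+x. ennreal (f x) \<partial>M"; cases "\<integral>\<^sup>+x. ennreal (- f x) \<partial>M")
      (auto simp: enn2ereal_ennreal)
qed

definition borel_prob_finite_mean :: "real measure \<Rightarrow> bool" where
  "borel_prob_finite_mean \<mu> \<longleftrightarrow>
     prob_space \<mu> \<and> sets \<mu> = sets borel \<and> integrable \<mu> (\<lambda>x. x)"

definition convex_order :: "real measure \<Rightarrow> real measure \<Rightarrow> bool" where
  "convex_order \<mu> \<nu> \<longleftrightarrow>
     borel_prob_finite_mean \<mu> \<and> borel_prob_finite_mean \<nu> \<and>
     (\<forall>\<phi> :: real \<Rightarrow> real. convex_on UNIV \<phi> \<longrightarrow> ext_integral \<mu> \<phi> \<le> ext_integral \<nu> \<phi>)"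

text \<open>The conditional expectation of \<open>Y\<close> given the sigma-algebra generated by \<open>Z\<close>.\<close>

definition cond_exp_given :: "'a measure \<Rightarrow> ('a \<Rightarrow> real) \<Rightarrow> ('a \<Rightarrow> real) \<Rightarrow> 'a \<Rightarrow> real" where
  "cond_exp_given M Y Z = real_cond_exp M (vimage_algebra (space M) Z borel) Y"

end

theory Submission
  imports Defs
begin

text \<open>
  Write \<open>C\<^bsub>Z\<^esub>(k) = E[(Z - k)\<^sup>+]\<close>, so that \<open>C\<^bsub>X\<^esub> \<le> C\<^bsub>Y\<^esub>\<close> and the means agree. On the open set
  \<open>G = {C\<^bsub>X\<^esub> < C\<^bsub>Y\<^esub>}\<close> there is room to make \<open>X\<close> discrete: to obtain \<open>Z\<close>, move the mass of each cell of
  a dyadic partition of \<open>G\<close> to the end points of the cell, keeping the mean; off \<open>G\<close> put \<open>Z = X\<close>. Then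
  \<open>E[Z | X] = X\<close> and \<open>C\<^bsub>Z\<^esub> \<le> C\<^bsub>Y\<^esub>\<close>. The countably many atoms \<open>(c, p)\<close> of \<open>Z\<close> are embedded one at a time into
  \<open>\<Omega>\<close>, as a set \<open>A\<close> of mass \<open>p\<close> on which \<open>Y\<close> has mean \<open>c\<close> and which is an interval for the order induced
  by \<open>Y\<close>; this keeps the remainders in convex order. By a maximum principle for the difference of
  the call functions, what is left of \<open>Y\<close> in the end has the law of what is left of \<open>Z = X\<close>, and there
  \<open>X' = Y\<close>. On each \<open>A\<close> repeated splitting into sets on which \<open>Y\<close> still has mean \<open>c\<close> gives a function
  \<open>V\<close> with atomless law and \<open>E[Y | V] = c\<close>, and \<open>X'\<close> is a function of \<open>V\<close> with the law of \<open>X\<close> given \<open>Z = c\<close>.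
\<close>

section \<open>Uniform ranks and order intervals\<close>

text \<open>The obstacle is that no randomness independent of \<open>Y\<close> need exist:
  \<open>Y\<close> may be injective. A martingale coupling of the two laws cannot be realised by
  tossing an extra coin, and \<open>X'\<close> has to be carved out of \<open>Y\<close> itself.
  Atoms can be carved: sliding a window through the order of \<open>Y\<close> finds a set of
  prescribed mass and mean. That it is an interval matters, since a set with the same mass and mean
  taken from the extremes of \<open>Y\<close> could leave a remainder too concentrated to dominate
  the rest. Carving handles countably many atoms, hence the passage to \<open>Z\<close>; where the
  call functions touch there is no room to spread mass, so it is not moved. Cell end points are
  dyadic, so an enumeration of the rationals lists all atoms in advance. The pair
  \<open>(X, Z)\<close> lives on an auxiliary space \<open>N\<close>. It suffices that the integral
  of \<open>Y\<close> where \<open>X'\<close> lies in \<open>B\<close> equals that of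
  \<open>Z\<close> where \<open>X\<close> lies in \<open>B\<close>, for the latter is the integral
  of the identity over \<open>B\<close>.\<close>

lemma (in finite_measure) exists_uniform_rank:
  assumes [measurable]: "R \<in> borel_measurable M"
    and cont: "\<And>r::real. measure M {\<omega>\<in>space M. R \<omega> = r} = 0"
  obtains F :: "real \<Rightarrow> real" where "mono F" "F \<in> borel_measurable borel"
    "\<And>t. 0 \<le> t \<Longrightarrow> t \<le> measure M (space M) \<Longrightarrow> measure M {\<omega>\<in>space M. F (R \<omega>) \<le> t} = t"
proof -
  let ?D = "distr M borel R"
  interpret D: finite_borel_measure ?D
    by (intro finite_borel_measure.intro finite_borel_measure_axioms.intro finite_measure_distr) auto
  have cdf_eq: "cdf ?D r = measure M {\<omega>\<in>space M. R \<omega> \<le> r}" for r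
    unfolding cdf_def by (subst measure_distr) (auto intro!: arg_cong[where f="measure M"])
  have isCont: "isCont (cdf ?D) r" for r
  proof -
    have "measure ?D {r} = measure M {\<omega>\<in>space M. R \<omega> = r}"
      by (subst measure_distr) (auto intro!: arg_cong[where f="measure M"])
    then show ?thesis
      by (simp add: D.isCont_cdf cont)
  qed
  have mono: "mono (cdf ?D)"
    by (auto simp: mono_def D.cdf_nondecreasing)
  have mass: "measure ?D UNIV = measure M (space M)"
    by (subst measure_distr) (auto intro!: arg_cong[where f="measure M"])
  have "measure M {\<omega>\<in>space M. cdf ?D (R \<omega>) \<le> t} = t"
    if t: "0 \<le> t" "t \<le> measure M (space M)" for t
  proof (cases "t = measure M (space M)")
    case True
    then have "{\<omega>\<in>space M. cdf ?D (R \<omega>) \<le> t} = space M"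
      using D.cdf_bounded mass by auto
    with True show ?thesis by simp
  next
    case False
    define J where "J = {r. cdf ?D r \<le> t}"
    show ?thesis
    proof (cases "J = {}")
      \<comment> \<open>An empty \<open>J\<close> forces \<open>t = 0\<close>, because the
        distribution function tends to 0 at minus infinity.\<close>
      case True
      then have "t \<le> cdf ?D r" for r
        by (auto simp: J_def not_le intro: less_imp_le)
      then have "t \<le> 0"
        by (intro tendsto_lowerbound[OF D.cdf_lim_at_bot]) auto
      moreover have empty: "{\<omega>\<in>space M. cdf ?D (R \<omega>) \<le> t} = {}"
        using True by (auto simp: J_def)
      ultimately show ?thesis
        using t unfolding empty by simp
    next
      case ne: False
      have "eventually (\<lambda>r. t < cdf ?D r) at_top"
        using D.cdf_lim_at_top False t by (intro order_tendstoD) (auto simp: mass)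
      then obtain u where u: "t < cdf ?D u"
        by (auto simp: eventually_at_top_linorder)
      have bdd: "bdd_above J"
      proof (rule bdd_aboveI)
        fix r assume "r \<in> J"
        then show "r \<le> u"
          using u D.cdf_nondecreasing[of u r] by (force simp: J_def)
      qed
      define r0 where "r0 = Sup J"
      \<comment> \<open>The absence of atoms enters here: a jump across \<open>t\<close> would keep
        \<open>r0\<close> out of \<open>J\<close>.\<close>
      have closed: "closed J"
        unfolding J_def using isCont
        by (intro closed_Collect_le continuous_at_imp_continuous_on) auto
      have "r0 \<in> J"
        unfolding r0_def by (rule closed_contains_Sup[OF ne bdd closed])
      have iff: "cdf ?D r \<le> t \<longleftrightarrow> r \<le> r0" for r
      proof
        assume "cdf ?D r \<le> t"
        then show "r \<le> r0"
          unfolding r0_def by (intro cSup_upper bdd) (auto simp: J_def)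
      next
        assume "r \<le> r0"
        then show "cdf ?D r \<le> t"
          using D.cdf_nondecreasing[of r r0] \<open>r0 \<in> J\<close> by (auto simp: J_def)
      qed
      have "t \<le> cdf ?D r0"
      proof (rule tendsto_lowerbound)
        show "(cdf ?D \<longlongrightarrow> cdf ?D r0) (at_right r0)"
          using isCont[of r0] by (auto simp: isCont_def intro: filterlim_mono[OF _ order_refl at_le])
        show "eventually (\<lambda>r. t \<le> cdf ?D r) (at_right r0)"
          unfolding eventually_at_right_field using iff
          by (metis less_add_one not_le less_imp_le)
      qed auto
      then have "cdf ?D r0 = t"
        using \<open>r0 \<in> J\<close> by (auto simp: J_def)
      then show ?thesis
        using cdf_eq[of r0] by (simp add: iff)
    qed
  qed
  then show thesis
    by (intro that[of "cdf ?D"] mono borel_measurable_mono) auto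
qed

text \<open>The level lies in the shell between \<open>s - e\<close> and \<open>s\<close>, which has
  mass \<open>e\<close>; if \<open>s\<close> is at most \<open>e\<close>, the whole sublevel set is
  small enough.\<close>

lemma (in finite_measure) measure_level_eq_0:
  assumes [measurable]: "U \<in> borel_measurable M"
    and unif: "\<And>t::real. 0 \<le> t \<Longrightarrow> t \<le> measure M (space M) \<Longrightarrow> measure M {\<omega>\<in>space M. U \<omega> \<le> t} = t"
    and s: "0 \<le> s" "s \<le> measure M (space M)"
  shows "measure M {\<omega>\<in>space M. U \<omega> = s} = 0"
proof (rule antisym[OF field_le_epsilon measure_nonneg])
  fix e :: real assume e: "0 < e"
  show "measure M {\<omega>\<in>space M. U \<omega> = s} \<le> 0 + e"
  proof (cases "e < s")
    case True
    have "measure M {\<omega>\<in>space M. U \<omega> = s} \<le> measure M ({\<omega>\<in>space M. U \<omega> \<le> s} - {\<omega>\<in>space M. U \<omega> \<le> s - e})"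
      using e by (intro finite_measure_mono) auto
    also have "\<dots> = e"
      using e True s unif[of s] unif[of "s - e"] by (subst finite_measure_Diff) auto
    finally show ?thesis by simp
  next
    case False
    have "measure M {\<omega>\<in>space M. U \<omega> = s} \<le> measure M {\<omega>\<in>space M. U \<omega> \<le> s}"
      by (intro finite_measure_mono) auto
    then show ?thesis
      using False s unif[of s] by simp
  qed
qed

text \<open>Dominated convergence: the indicators converge off the level \<open>s\<close>, which is
  null. The continuity feeds the intermediate value argument in
  \<open>select_order_interval\<close>.\<close>

lemma (in finite_measure) continuous_on_integral_rank:
  fixes f :: "'a \<Rightarrow> real"
  assumes [measurable]: "U \<in> borel_measurable M"
    and unif: "\<And>t::real. 0 \<le> t \<Longrightarrow> t \<le> measure M (space M) \<Longrightarrow> measure M {\<omega>\<in>space M. U \<omega> \<le> t} = t"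
    and f: "integrable M f"
  shows "continuous_on {0..measure M (space M)} (\<lambda>s. LINT \<omega>:{\<omega>\<in>space M. U \<omega> \<le> s}|M. f \<omega>)"
  unfolding continuous_on_sequentially comp_def
proof (intro allI ballI impI, elim conjE)
  fix x :: "nat \<Rightarrow> real" and s :: real
  assume s: "s \<in> {0..measure M (space M)}" and x: "x \<longlonglongrightarrow> s"
  have [measurable]: "f \<in> borel_measurable M"
    using f by simp
  have "{\<omega>\<in>space M. U \<omega> = s} \<in> null_sets M"
    using measure_level_eq_0[OF assms(1) unif] s by (auto simp: null_sets_def emeasure_eq_measure)
  then have ne: "AE \<omega> in M. U \<omega> \<noteq> s"
    by (rule AE_I') auto
  have lim: "(\<lambda>n. indicator {\<omega>\<in>space M. U \<omega> \<le> x n} \<omega> *\<^sub>R f \<omega>) \<longlonglongrightarrow> indicator {\<omega>\<in>space M. U \<omega> \<le> s} \<omega> *\<^sub>R f \<omega>"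
    if "U \<omega> \<noteq> s" for \<omega>
  proof (rule tendsto_eventually)
    consider "U \<omega> < s" | "s < U \<omega>"
      using \<open>U \<omega> \<noteq> s\<close> by linarith
    then show "\<forall>\<^sub>F n in sequentially. indicator {\<omega>\<in>space M. U \<omega> \<le> x n} \<omega> *\<^sub>R f \<omega> = indicator {\<omega>\<in>space M. U \<omega> \<le> s} \<omega> *\<^sub>R f \<omega>"
    proof cases
      case 1
      from order_tendstoD(1)[OF x 1] show ?thesis
        by eventually_elim (use 1 in \<open>auto simp: indicator_def\<close>)
    next
      case 2
      from order_tendstoD(2)[OF x 2] show ?thesis
        by eventually_elim (use 2 in \<open>auto simp: indicator_def\<close>)
    qed
  qed
  show "(\<lambda>n. LINT \<omega>:{\<omega>\<in>space M. U \<omega> \<le> x n}|M. f \<omega>) \<longlonglongrightarrow> (LINT \<omega>:{\<omega>\<in>space M. U \<omega> \<le> s}|M. f \<omega>)"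
    unfolding set_lebesgue_integral_def
  proof (rule integral_dominated_convergence[where w="\<lambda>\<omega>. norm (f \<omega>)"])
    show "AE \<omega> in M. (\<lambda>n. indicator {\<omega>\<in>space M. U \<omega> \<le> x n} \<omega> *\<^sub>R f \<omega>) \<longlonglongrightarrow> indicator {\<omega>\<in>space M. U \<omega> \<le> s} \<omega> *\<^sub>R f \<omega>"
      using ne by eventually_elim (rule lim)
    show "integrable M (\<lambda>\<omega>. norm (f \<omega>))"
      using f by simp
  qed (auto simp: indicator_def)
qed

lemma set_integrable_of_integrable:
  fixes f :: "'a \<Rightarrow> real"
  assumes "integrable M f" "A \<in> sets M"
  shows "set_integrable M A f"
  using integrable_mult_indicator[OF assms(2,1)] by (simp add: set_integrable_def)

lemma set_integral_split:
  fixes f :: "'a \<Rightarrow> real"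
  assumes "integrable M f" "A \<in> sets M" "B \<in> sets M" "A \<inter> B = {}" 
  shows "(LINT \<omega>:A \<union> B|M. f \<omega>) = (LINT \<omega>:A|M. f \<omega>) + (LINT \<omega>:B|M. f \<omega>)"
  using assms by (intro set_integral_Un set_integrable_of_integrable) auto

lemma (in finite_measure) set_integral_diff_const:
  assumes "integrable M (Y::'a\<Rightarrow>real)" "A \<in> sets M"
  shows "(LINT \<omega>:A|M. Y \<omega> - k) = (LINT \<omega>:A|M. Y \<omega>) - k * measure M A"
    "(LINT \<omega>:A|M. k - Y \<omega>) = k * measure M A - (LINT \<omega>:A|M. Y \<omega>)"
  using assms by (simp_all add: set_integral_diff set_integral_const set_integrable_of_integrable)

text \<open>Thresholds on \<open>Y\<close> cannot cut its atoms. \<open>R\<close> breaks the ties: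
  its law has no atoms, and by \<open>monotone_R\<close> an interval of ranks is an order interval
  for \<open>Y\<close>, with ties allowed at both ends.\<close>

locale ranked = finite_measure M for M :: "'a measure" +
  fixes Y R :: "'a \<Rightarrow> real"
  assumes integrable_Y: "integrable M Y"
    and measurable_R [measurable]: "R \<in> borel_measurable M"
    and level_R: "\<And>r. measure M {\<omega>\<in>space M. R \<omega> = r} = 0"
    and monotone_R: "\<And>\<omega> \<omega>'. \<omega> \<in> space M \<Longrightarrow> \<omega>' \<in> space M \<Longrightarrow> Y \<omega> < Y \<omega>' \<Longrightarrow> R \<omega> < R \<omega>'"
begin

lemma measurable_Y [measurable]: "Y \<in> borel_measurable M"
  using integrable_Y by simp

text \<open>Among the windows of mass \<open>p\<close> in the order of ranks, the mean of
  \<open>Y\<close> varies continuously from its lowest to its highest value. The put and call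
  hypotheses say that \<open>c\<close> lies between these extremes; they hold for every atom that is
  part of a dominated law.\<close>

lemma select_order_interval:
  assumes p: "0 < p" "p < measure M (space M)"
    and call: "\<And>k. p * (c - k) \<le> (\<integral>\<omega>. max 0 (Y \<omega> - k) \<partial>M)"
    and put: "\<And>k. p * (k - c) \<le> (\<integral>\<omega>. max 0 (k - Y \<omega>) \<partial>M)"
  obtains L A H where "L \<in> sets M" "A \<in> sets M" "H \<in> sets M" "space M = L \<union> A \<union> H"
    "L \<inter> A = {}" "L \<inter> H = {}" "A \<inter> H = {}" "measure M A = p" "(LINT \<omega>:A|M. Y \<omega>) = c * p"
    "\<And>\<omega> \<omega>'. \<omega> \<in> L \<Longrightarrow> \<omega>' \<in> A \<union> H \<Longrightarrow> Y \<omega> \<le> Y \<omega>'" "\<And>\<omega> \<omega>'. \<omega> \<in> A \<Longrightarrow> \<omega>' \<in> H \<Longrightarrow> Y \<omega> \<le> Y \<omega>'"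
proof -
  obtain F where F: "mono F" "F \<in> borel_measurable borel"
    "\<And>t. 0 \<le> t \<Longrightarrow> t \<le> measure M (space M) \<Longrightarrow> measure M {\<omega>\<in>space M. F (R \<omega>) \<le> t} = t"
    using exists_uniform_rank[OF measurable_R level_R] by blast
  define m where "m = measure M (space M)"
  define U where "U = F \<circ> R"
  have U[measurable]: "U \<in> borel_measurable M"
    unfolding U_def using F(2) by measurable
  have unif: "measure M {\<omega>\<in>space M. U \<omega> \<le> t} = t" if "0 \<le> t" "t \<le> measure M (space M)" for t
    using F(3) that by (auto simp: U_def)
  have ord: "Y \<omega> \<le> Y \<omega>'" if "\<omega> \<in> space M" "\<omega>' \<in> space M" "U \<omega> < U \<omega>'" for \<omega> \<omega>'
    using monotone_R[of \<omega>' \<omega>] that monoD[OF F(1), of "R \<omega>'" "R \<omega>"] by (force simp: U_def)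
  define I where "I s = (LINT \<omega>:{\<omega>\<in>space M. U \<omega> \<le> s}|M. Y \<omega>)" for s
  have I_cont: "continuous_on {0..m} I"
    unfolding I_def m_def by (rule continuous_on_integral_rank[OF U unif integrable_Y])
  \<comment> \<open>At a strike that separates the values of \<open>Y\<close> below rank
    \<open>t\<close> from those above it, a put or call is an integral over one side of the
    cut.\<close>
  have thr: "\<exists>k. (\<forall>\<omega>\<in>space M. U \<omega> \<le> t \<longrightarrow> Y \<omega> \<le> k) \<and> (\<forall>\<omega>\<in>space M. t < U \<omega> \<longrightarrow> k \<le> Y \<omega>)"
    if t: "0 < t" "t < m" for t
  proof -
    have "measure M {\<omega>\<in>space M. U \<omega> \<le> t} \<noteq> measure M {}"
      using unif[of t] t by (simp add: m_def)
    then have "{\<omega>\<in>space M. U \<omega> \<le> t} \<noteq> {}"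
      by metis
    then obtain \<omega>0 where w0: "\<omega>0 \<in> space M" "U \<omega>0 \<le> t" by auto
    have "\<exists>\<omega>\<in>space M. t < U \<omega>"
    proof (rule ccontr)
      assume "\<not> (\<exists>\<omega>\<in>space M. t < U \<omega>)"
      then have eq: "{\<omega>\<in>space M. U \<omega> \<le> t} = space M"
        by (auto simp: not_less)
      show False
        using unif[of t] t unfolding eq m_def by simp
    qed
    then obtain \<omega>1 where w1: "\<omega>1 \<in> space M" "t < U \<omega>1" by auto
    define k where "k = Sup (Y ` {\<omega>\<in>space M. U \<omega> \<le> t})"
    have "bdd_above (Y ` {\<omega>\<in>space M. U \<omega> \<le> t})"
      using ord w1 by (intro bdd_aboveI[of _ "Y \<omega>1"]) auto
    then have 1: "\<forall>\<omega>\<in>space M. U \<omega> \<le> t \<longrightarrow> Y \<omega> \<le> k"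
      unfolding k_def by (auto intro!: cSup_upper)
    have 2: "\<forall>\<omega>\<in>space M. t < U \<omega> \<longrightarrow> k \<le> Y \<omega>"
      unfolding k_def using w0 by (auto intro!: cSup_least ord)
    from 1 2 show ?thesis by blast
  qed
  have total: "(\<integral>\<omega>. Y \<omega> \<partial>M) = I m"
  proof -
    have "AE \<omega> in M. U \<omega> \<le> m"
    proof (rule AE_I')
      have "measure M (space M - {\<omega>\<in>space M. U \<omega> \<le> m}) = 0"
        using unif[of m] by (subst finite_measure_Diff) (auto simp: m_def)
      then show "space M - {\<omega>\<in>space M. U \<omega> \<le> m} \<in> null_sets M"
        by (auto simp: null_sets_def emeasure_eq_measure)
    qed auto
    then show ?thesis
      unfolding I_def set_lebesgue_integral_def
      by (intro integral_cong_AE) (auto simp: indicator_def)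
  qed
  have I0: "I 0 = 0"
  proof -
    have "{\<omega>\<in>space M. U \<omega> \<le> 0} \<in> null_sets M"
      using unif[of 0] by (auto simp: null_sets_def emeasure_eq_measure)
    then have "AE \<omega> in M. \<not> U \<omega> \<le> 0"
      by (rule AE_I') auto
    then have "I 0 = (\<integral>\<omega>. 0 \<partial>M)"
      unfolding I_def set_lebesgue_integral_def
      by (intro integral_cong_AE) (auto simp: indicator_def)
    then show ?thesis by simp
  qed
  \<comment> \<open>The put at the separating strike of rank \<open>p\<close> equals
    \<open>k * p - I p\<close>; the hypothesis bounds it below by \<open>p * (k - c)\<close>. The
    upper bound uses the call at rank \<open>m - p\<close> in the same way.\<close>
  have low: "I p \<le> c * p"
  proof -
    obtain k where k: "\<And>\<omega>. \<omega> \<in> space M \<Longrightarrow> U \<omega> \<le> p \<Longrightarrow> Y \<omega> \<le> k" "\<And>\<omega>. \<omega> \<in> space M \<Longrightarrow> p < U \<omega> \<Longrightarrow> k \<le> Y \<omega>"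
      using thr[of p] p by (auto simp: m_def)
    have "(\<integral>\<omega>. max 0 (k - Y \<omega>) \<partial>M) = (LINT \<omega>:{\<omega>\<in>space M. U \<omega> \<le> p}|M. k - Y \<omega>)"
      unfolding set_lebesgue_integral_def
      using k by (intro Bochner_Integration.integral_cong) (force simp: indicator_def max_def)+
    also have "\<dots> = k * p - I p"
      using unif[of p] p integrable_Y by (subst set_integral_diff_const) (auto simp: I_def)
    finally show ?thesis
      using put[of k] by (simp add: algebra_simps)
  qed
  have high: "c * p \<le> I m - I (m - p)"
  proof -
    obtain k where k: "\<And>\<omega>. \<omega> \<in> space M \<Longrightarrow> U \<omega> \<le> m - p \<Longrightarrow> Y \<omega> \<le> k" "\<And>\<omega>. \<omega> \<in> space M \<Longrightarrow> m - p < U \<omega> \<Longrightarrow> k \<le> Y \<omega>"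
      using thr[of "m - p"] p by (auto simp: m_def)
    have "(\<integral>\<omega>. max 0 (Y \<omega> - k) \<partial>M) = (\<integral>\<omega>. Y \<omega> - k - indicator {\<omega>\<in>space M. U \<omega> \<le> m - p} \<omega> *\<^sub>R (Y \<omega> - k) \<partial>M)"
      using k by (intro Bochner_Integration.integral_cong) (force simp: indicator_def max_def)+
    also have "\<dots> = (\<integral>\<omega>. Y \<omega> - k \<partial>M) - (LINT \<omega>:{\<omega>\<in>space M. U \<omega> \<le> m - p}|M. Y \<omega> - k)"
      unfolding set_lebesgue_integral_def using integrable_Y
      by (intro Bochner_Integration.integral_diff integrable_mult_indicator) auto
    also have "\<dots> = (I m - k * m) - (I (m - p) - k * (m - p))"
      using unif[of "m - p"] p integrable_Y
      by (subst set_integral_diff_const) (auto simp: I_def m_def total)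
    finally show ?thesis
      using call[of k] by (simp add: algebra_simps)
  qed
  have "\<exists>s. 0 \<le> s \<and> s \<le> m - p \<and> I (s + p) - I s = c * p"
  proof (rule IVT')
    show "I (0 + p) - I 0 \<le> c * p" "c * p \<le> I (m - p + p) - I (m - p)"
      using low high I0 by simp_all
    show "continuous_on {0..m - p} (\<lambda>s. I (s + p) - I s)"
      using p by (intro continuous_intros continuous_on_compose2[OF I_cont]) (auto simp: m_def)
  qed (use p in \<open>auto simp: m_def\<close>)
  then obtain s where s: "0 \<le> s" "s \<le> m - p" "I (s + p) - I s = c * p" by blast
  let ?L = "{\<omega>\<in>space M. U \<omega> \<le> s}" and ?A = "{\<omega>\<in>space M. s < U \<omega> \<and> U \<omega> \<le> s + p}" and ?H = "{\<omega>\<in>space M. s + p < U \<omega>}"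
  have Un: "{\<omega>\<in>space M. U \<omega> \<le> s + p} = ?L \<union> ?A"
    using p by auto
  show thesis
  proof (rule that[of ?L ?A ?H])
    have "measure M (?L \<union> ?A) = measure M ?L + measure M ?A"
      by (intro finite_measure_Union) auto
    then show "measure M ?A = p"
      using unif[of s] unif[of "s + p"] s p by (simp add: Un m_def)
    have "I (s + p) = I s + (LINT \<omega>:?A|M. Y \<omega>)"
      unfolding I_def Un by (rule set_integral_split[OF integrable_Y]) auto
    then show "(LINT \<omega>:?A|M. Y \<omega>) = c * p"
      using s by simp
  qed (use p in \<open>auto intro: ord\<close>)
qed

end

section \<open>Extraction of atoms in convex order\<close>

lemma set_integral_nonneg_of_nonneg:
  fixes f :: "'a \<Rightarrow> real"
  assumes "\<And>\<omega>. \<omega> \<in> A \<Longrightarrow> 0 \<le> f \<omega>"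
  shows "0 \<le> (LINT \<omega>:A|M. f \<omega>)"
  unfolding set_lebesgue_integral_def using assms
  by (intro Bochner_Integration.integral_nonneg) (auto simp: indicator_def)

lemma set_integral_eqI:
  fixes f g :: "'a \<Rightarrow> real"
  assumes "\<And>\<omega>. \<omega> \<in> A \<Longrightarrow> f \<omega> = g \<omega>"
  shows "(LINT \<omega>:A|M. f \<omega>) = (LINT \<omega>:A|M. g \<omega>)"
  unfolding set_lebesgue_integral_def using assms
  by (intro Bochner_Integration.integral_cong) (auto simp: indicator_def)

lemma set_integral_empty [simp]: "(LINT \<omega>:{}|M. f \<omega>) = (0 :: real)"
  by (simp add: set_lebesgue_integral_def)

lemma set_integral_leI:
  fixes f g :: "'a \<Rightarrow> real"
  assumes "integrable M f" "integrable M g" "A \<in> sets M" "\<And>\<omega>. \<omega> \<in> A \<Longrightarrow> f \<omega> \<le> g \<omega>"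
  shows "(LINT \<omega>:A|M. f \<omega>) \<le> (LINT \<omega>:A|M. g \<omega>)"
  using assms by (intro set_integral_mono set_integrable_of_integrable) auto

lemma (in finite_measure) set_integral_measure_zero:
  fixes f :: "'a \<Rightarrow> real"
  assumes [measurable]: "A \<in> sets M" "f \<in> borel_measurable M" and "measure M A = 0"
  shows "(LINT \<omega>:A|M. f \<omega>) = 0"
proof -
  have "A \<in> null_sets M"
    using assms by (auto simp: null_sets_def emeasure_eq_measure)
  then have "AE \<omega> in M. \<omega> \<notin> A"
    by (rule AE_not_in)
  then have "(LINT \<omega>:A|M. f \<omega>) = (\<integral>\<omega>. 0 \<partial>M)"
    unfolding set_lebesgue_integral_def
    by (intro integral_cong_AE) (auto simp: indicator_def)
  then show ?thesis by simp
qed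

text \<open>Unnormalised and relative to a set, so that it is additive over disjoint pieces and
  atoms can be subtracted.\<close>

definition call :: "'a measure \<Rightarrow> ('a \<Rightarrow> real) \<Rightarrow> 'a set \<Rightarrow> real \<Rightarrow> real" where
  "call M Y S k = (LINT \<omega>:S|M. max 0 (Y \<omega> - k))"

text \<open>Convex order of the two restricted, unnormalised laws: given equal mass and mean, call
  payoffs test all convex functions. Stated for subsets so that matching pieces can be removed from
  both sides.\<close>

definition dominates ::
  "'a measure \<Rightarrow> ('a \<Rightarrow> real) \<Rightarrow> 'a set \<Rightarrow> 'b measure \<Rightarrow> ('b \<Rightarrow> real) \<Rightarrow> 'b set \<Rightarrow> bool" where
  "dominates M Y S N Z T \<longleftrightarrow>
     measure M S = measure N T \<and> (LINT \<omega>:S|M. Y \<omega>) = (LINT \<omega>:T|N. Z \<omega>) \<and>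
     (\<forall>k. call N Z T k \<le> call M Y S k)"

context finite_measure
begin

lemma call_nonneg: "0 \<le> call M Y S k"
  unfolding call_def by (rule set_integral_nonneg_of_nonneg) auto

lemma call_split:
  assumes "integrable M Y" "A \<in> sets M" "B \<in> sets M" "A \<inter> B = {}"
  shows "call M Y (A \<union> B) k = call M Y A k + call M Y B k"
  unfolding call_def using assms by (intro set_integral_split) auto

lemma call_Diff:
  assumes "integrable M Y" "A \<in> sets M" "B \<in> sets M" "B \<subseteq> A"
  shows "call M Y (A - B) k = call M Y A k - call M Y B k"
proof -
  have "(A - B) \<inter> B = {}"
    by blast
  from call_split[OF assms(1) _ _ this] show ?thesis
    using assms by (simp add: Un_absorb2)
qed

lemma set_integral_Diff:
  fixes Y :: "'a \<Rightarrow> real"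
  assumes "integrable M Y" "A \<in> sets M" "B \<in> sets M" "B \<subseteq> A"
  shows "(LINT \<omega>:A - B|M. Y \<omega>) = (LINT \<omega>:A|M. Y \<omega>) - (LINT \<omega>:B|M. Y \<omega>)"
proof -
  have "(A - B) \<inter> B = {}"
    by blast
  from set_integral_split[OF assms(1) _ _ this] show ?thesis
    using assms by (simp add: Un_absorb2)
qed

lemma call_eq_if_ge:
  assumes "integrable M Y" "A \<in> sets M" "\<And>\<omega>. \<omega> \<in> A \<Longrightarrow> k \<le> Y \<omega>"
  shows "call M Y A k = (LINT \<omega>:A|M. Y \<omega>) - k * measure M A"
proof -
  have "call M Y A k = (LINT \<omega>:A|M. Y \<omega> - k)"
    unfolding call_def using assms(3) by (intro set_integral_eqI) auto
  then show ?thesis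
    using assms by (simp add: set_integral_diff_const)
qed

lemma call_eq_0_if_le:
  assumes "\<And>\<omega>. \<omega> \<in> A \<Longrightarrow> Y \<omega> \<le> k"
  shows "call M Y A k = 0"
proof -
  have "call M Y A k = (LINT \<omega>:A|M. 0)"
    unfolding call_def using assms by (intro set_integral_eqI) auto
  then show ?thesis by simp
qed

text \<open>Convexity of the positive part. The left-hand side is the call function of a single atom
  with the mass and mean of \<open>A\<close>.\<close>

lemma call_Jensen:
  assumes Y: "integrable M Y" and A: "A \<in> sets M"
  shows "max 0 ((LINT \<omega>:A|M. Y \<omega>) - k * measure M A) \<le> call M Y A k"
proof -
  have "(LINT \<omega>:A|M. Y \<omega> - k) \<le> call M Y A k"
    unfolding call_def using Y A by (intro set_integral_leI) auto
  then show ?thesis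
    using Y A call_nonneg by (simp add: set_integral_diff_const)
qed

text \<open>Integrates (y - k)^+ - (k - y)^+ = y - k. The correction depends on mass and mean only,
  so \<open>dominates\<close> orders the puts as well.\<close>

lemma call_put_parity:
  assumes Y: "integrable M Y" and A: "A \<in> sets M"
  shows "(LINT \<omega>:A|M. max 0 (k - Y \<omega>)) = call M Y A k - ((LINT \<omega>:A|M. Y \<omega>) - k * measure M A)"
proof -
  have "(LINT \<omega>:A|M. max 0 (k - Y \<omega>)) = (LINT \<omega>:A|M. max 0 (Y \<omega> - k) - (Y \<omega> - k))"
    by (intro set_integral_eqI) auto
  also have "\<dots> = call M Y A k - (LINT \<omega>:A|M. Y \<omega> - k)"
    unfolding call_def using Y A by (intro set_integral_diff set_integrable_of_integrable) auto
  finally show ?thesis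
    using Y A by (simp add: set_integral_diff_const)
qed

lemma call_antimono:
  assumes Y: "integrable M Y" and A: "A \<in> sets M" and "k \<le> k'"
  shows "call M Y A k' \<le> call M Y A k"
  unfolding call_def using assms by (intro set_integral_leI) auto

lemma call_convex:
  assumes Y: "integrable M Y" and A: "A \<in> sets M" and u: "0 \<le> u" "u \<le> 1"
  shows "call M Y A (u * a + (1 - u) * b) \<le> u * call M Y A a + (1 - u) * call M Y A b"
proof -
  have "call M Y A (u * a + (1 - u) * b) \<le> (LINT \<omega>:A|M. u * max 0 (Y \<omega> - a) + (1 - u) * max 0 (Y \<omega> - b))"
    unfolding call_def
  proof (rule set_integral_leI)
    fix \<omega>
    have "Y \<omega> - (u * a + (1 - u) * b) = u * (Y \<omega> - a) + (1 - u) * (Y \<omega> - b)"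
      by (simp add: algebra_simps)
    also have "\<dots> \<le> u * max 0 (Y \<omega> - a) + (1 - u) * max 0 (Y \<omega> - b)"
      using u by (intro add_mono mult_left_mono) auto
    finally show "max 0 (Y \<omega> - (u * a + (1 - u) * b)) \<le> u * max 0 (Y \<omega> - a) + (1 - u) * max 0 (Y \<omega> - b)"
      using u by simp
  qed (use Y A in auto)
  also have "\<dots> = u * call M Y A a + (1 - u) * call M Y A b"
    unfolding call_def using Y A
    by (subst set_integral_add(2)) (auto intro!: set_integrable_of_integrable)
  finally show ?thesis .
qed

end

text \<open>
  Removing an order interval \<open>A\<close> on the dominating side and an atom of the same mass and mean on
  the dominated side: the call function of the remainder is affine across the range of \<open>Y\<close> on
  \<open>A\<close>, so that convexity reduces the strikes in this range to its end points.
\<close>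

lemma dominates_remove_order_interval:
  assumes "finite_measure M" "finite_measure N" and Y: "integrable M Y" and Z: "integrable N Z"
    and meas: "L \<in> sets M" "A \<in> sets M" "H \<in> sets M" "T \<in> sets N" "C \<in> sets N"
    and disj: "L \<inter> A = {}" "L \<inter> H = {}" "A \<inter> H = {}" and C: "C \<subseteq> T" "\<And>\<omega>. \<omega> \<in> C \<Longrightarrow> Z \<omega> = c"
    and mass: "measure M A = measure N C" and mean: "(LINT \<omega>:A|M. Y \<omega>) = c * measure N C"
    and LA: "\<And>\<omega> \<omega>'. \<omega> \<in> L \<Longrightarrow> \<omega>' \<in> A \<union> H \<Longrightarrow> Y \<omega> \<le> Y \<omega>'"
    and AH: "\<And>\<omega> \<omega>'. \<omega> \<in> A \<Longrightarrow> \<omega>' \<in> H \<Longrightarrow> Y \<omega> \<le> Y \<omega>'"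
    and ne: "L \<union> H \<noteq> {}" and dom: "dominates M Y (L \<union> A \<union> H) N Z T"
  shows "dominates M Y (L \<union> H) N Z (T - C)"
proof -
  interpret M: finite_measure M by fact
  interpret N: finite_measure N by fact
  define p where "p = measure N C"
  define t where "t = measure N (T - C)"
  define e where "e = (LINT \<omega>:T - C|N. Z \<omega>)"
  have meanC: "(LINT \<omega>:C|N. Z \<omega>) = c * p"
  proof -
    have "(LINT \<omega>:C|N. Z \<omega>) = (LINT \<omega>:C|N. c)"
      using C by (intro set_integral_eqI) auto
    then show ?thesis
      using meas by (simp add: set_integral_const p_def)
  qed
  have mLAH: "measure M (L \<union> A \<union> H) = measure M (L \<union> H) + measure M A"
    using disj meas by (subst M.finite_measure_Union[symmetric]) (auto simp: Un_ac Int_Un_distrib)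
  have mT: "measure N T = t + p"
    using C meas by (simp add: t_def p_def N.finite_measure_Diff)
  have mLH: "measure M (L \<union> H) = t"
    using dom mLAH mT mass by (simp add: dominates_def p_def)
  have eLAH: "(LINT \<omega>:L \<union> A \<union> H|M. Y \<omega>) = (LINT \<omega>:L \<union> H|M. Y \<omega>) + (LINT \<omega>:A|M. Y \<omega>)"
    using disj meas Y by (subst set_integral_split[symmetric]) (auto simp: Un_ac Int_Un_distrib)
  have eLH: "(LINT \<omega>:L \<union> H|M. Y \<omega>) = e"
    using dom eLAH mean meanC meas C Z by (simp add: dominates_def p_def e_def N.set_integral_Diff)
  have callS: "call M Y (L \<union> A \<union> H) k = call M Y L k + call M Y A k + call M Y H k" for k
    using disj meas Y by (simp add: M.call_split Int_Un_distrib2)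
  have callLH: "call M Y (L \<union> H) k = call M Y L k + call M Y H k" for k
    using disj meas Y by (simp add: M.call_split)
  have callC: "max 0 (p * (c - k)) \<le> call N Z C k" for k
    using N.call_Jensen[OF Z \<open>C \<in> sets N\<close>, of k] by (simp add: meanC p_def algebra_simps)
  have callT: "call N Z (T - C) k \<le> call M Y (L \<union> A \<union> H) k - max 0 (p * (c - k))" for k
    using callC[of k] dom meas C Z by (simp add: dominates_def N.call_Diff) (smt (verit))
  have below: "call N Z (T - C) k \<le> call M Y (L \<union> H) k" if "\<And>\<omega>. \<omega> \<in> A \<Longrightarrow> k \<le> Y \<omega>" for k
    using callT[of k] M.call_eq_if_ge[OF Y \<open>A \<in> sets M\<close> that] mean mass
    by (simp add: callS callLH p_def algebra_simps)
  have above: "call N Z (T - C) k \<le> call M Y (L \<union> H) k" if "\<And>\<omega>. \<omega> \<in> A \<Longrightarrow> Y \<omega> \<le> k" for k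
    using callT[of k] M.call_eq_0_if_le[of A Y k, OF that] by (simp add: callS callLH)
  have "call N Z (T - C) k \<le> call M Y (L \<union> H) k" for k
  proof (cases "(\<forall>\<omega>\<in>A. k \<le> Y \<omega>) \<or> (\<forall>\<omega>\<in>A. Y \<omega> \<le> k)")
    case True
    then show ?thesis
      using below[of k] above[of k] by blast
  next
    case False
    then obtain \<omega>1 \<omega>2 where w: "\<omega>1 \<in> A" "Y \<omega>1 < k" "\<omega>2 \<in> A" "k < Y \<omega>2"
      by (auto simp: not_le)
    define h where "h = measure M H"
    define d where "d = (LINT \<omega>:H|M. Y \<omega>)"
    have across: "call M Y (L \<union> H) k' = d - k' * h"
      if "\<And>\<omega>. \<omega> \<in> L \<Longrightarrow> Y \<omega> \<le> k'" "\<And>\<omega>. \<omega> \<in> H \<Longrightarrow> k' \<le> Y \<omega>" for k'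
      using M.call_eq_0_if_le[of L Y k', OF that(1)] M.call_eq_if_ge[OF Y \<open>H \<in> sets M\<close> that(2)]
      by (simp add: callLH d_def h_def)
    have at_k: "call M Y (L \<union> H) k = d - k * h"
    proof (rule across)
      show "Y \<omega> \<le> k" if "\<omega> \<in> L" for \<omega>
        using LA[OF that, of \<omega>1] w by auto
      show "k \<le> Y \<omega>" if "\<omega> \<in> H" for \<omega>
        using AH[OF _ that, of \<omega>2] w by auto
    qed
    \<comment> \<open>\<open>a\<close> is the left end of the range of \<open>Y\<close> on
      \<open>A\<close>; a point of \<open>L\<close> is needed to bound this range from
      below.\<close>
    have lower: "\<exists>a<k. call N Z (T - C) a \<le> d - a * h" if L: "L \<noteq> {}"
    proof -
      define a where "a = Inf (Y ` A)"
      obtain \<omega>0 where "\<omega>0 \<in> L" using L by blast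
      then have bdd: "bdd_below (Y ` A)"
        using LA by (intro bdd_belowI[of _ "Y \<omega>0"]) auto
      have aA: "a \<le> Y \<omega>" if "\<omega> \<in> A" for \<omega>
        unfolding a_def using that bdd by (auto intro: cInf_lower)
      have La: "Y \<omega> \<le> a" if "\<omega> \<in> L" for \<omega>
        unfolding a_def using w LA that by (intro cInf_greatest) auto
      have aH: "a \<le> Y \<omega>" if "\<omega> \<in> H" for \<omega>
        using aA[OF w(3)] AH[OF w(3) that] by simp
      have "a < k"
        using aA[OF w(1)] w by simp
      moreover have "call N Z (T - C) a \<le> d - a * h"
        using below[of a, OF aA] across[of a, OF La aH] by simp
      ultimately show ?thesis by blast
    qed
    have upper: "\<exists>b>k. call N Z (T - C) b \<le> d - b * h" if H: "H \<noteq> {}"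
    proof -
      define b where "b = Sup (Y ` A)"
      obtain \<omega>0 where "\<omega>0 \<in> H" using H by blast
      then have bdd: "bdd_above (Y ` A)"
        using AH by (intro bdd_aboveI[of _ "Y \<omega>0"]) auto
      have bA: "Y \<omega> \<le> b" if "\<omega> \<in> A" for \<omega>
        unfolding b_def using that bdd by (auto intro: cSup_upper)
      have Hb: "b \<le> Y \<omega>" if "\<omega> \<in> H" for \<omega>
        unfolding b_def using w AH that by (intro cSup_least) auto
      have bL: "Y \<omega> \<le> b" if "\<omega> \<in> L" for \<omega>
        using bA[OF w(1)] LA[OF that, of \<omega>1] w by simp
      have "k < b"
        using bA[OF w(3)] w by simp
      moreover have "call N Z (T - C) b \<le> d - b * h"
        using above[of b, OF bA] across[of b, OF bL Hb] by simp
      ultimately show ?thesis by blast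
    qed
    have TC: "T - C \<in> sets N"
      using meas by auto
    \<comment> \<open>With both sides present, convexity interpolates between \<open>a\<close> and
      \<open>b\<close>. Without \<open>H\<close> the affine function is 0, and monotonicity carries
      the bound from \<open>a\<close> to \<open>k\<close>. Without \<open>L\<close> it is the lower
      bound of Jensen, so the put of the dominated remainder vanishes at \<open>b\<close>, hence at
      \<open>k\<close>.\<close>
    consider "L \<noteq> {}" "H \<noteq> {}" | "L \<noteq> {}" "H = {}" | "L = {}" "H \<noteq> {}"
      using ne by blast
    then show ?thesis
    proof cases
      case 1
      obtain a b where a: "a < k" "call N Z (T - C) a \<le> d - a * h"
        and b: "k < b" "call N Z (T - C) b \<le> d - b * h"
        using lower[OF 1(1)] upper[OF 1(2)] by blast
      define u where "u = (b - k) / (b - a)"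
      have u: "0 \<le> u" "u \<le> 1" "u * a + (1 - u) * b = k"
      proof -
        have "u * (b - a) = b - k"
          using a b by (simp add: u_def)
        then show "u * a + (1 - u) * b = k"
          by (simp add: algebra_simps)
      qed (use a b in \<open>auto simp: u_def\<close>)
      have "call N Z (T - C) k \<le> u * call N Z (T - C) a + (1 - u) * call N Z (T - C) b"
        using N.call_convex[OF Z TC u(1,2), of a b] u(3) by simp
      also have "\<dots> \<le> u * (d - a * h) + (1 - u) * (d - b * h)"
        using a b u by (intro add_mono mult_left_mono) auto
      also have "\<dots> = d - (u * a + (1 - u) * b) * h"
        by (simp add: algebra_simps)
      finally show ?thesis
        by (simp add: at_k u)
    next
      case 2
      then obtain a where a: "a < k" "call N Z (T - C) a \<le> d - a * h"
        using lower by blast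
      have "call N Z (T - C) k \<le> call N Z (T - C) a"
        using a by (intro N.call_antimono Z TC) simp
      then show ?thesis
        using at_k a 2 by (simp add: d_def h_def)
    next
      case 3
      then obtain b where b: "k < b" "call N Z (T - C) b \<le> d - b * h"
        using upper by blast
      have dh: "d = e" "h = t"
        using 3 eLH mLH by (simp_all add: d_def h_def)
      have "(LINT \<omega>:T - C|N. max 0 (k - Z \<omega>)) \<le> (LINT \<omega>:T - C|N. max 0 (b - Z \<omega>))"
        using b Z TC by (intro set_integral_leI) auto
      also have "\<dots> \<le> 0"
        using b(2) by (simp add: N.call_put_parity[OF Z TC] dh e_def t_def)
      finally show ?thesis
        by (simp add: N.call_put_parity[OF Z TC] at_k dh e_def t_def)
    qed
  qed
  then show ?thesis
    using mLH eLH by (simp add: dominates_def t_def e_def)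
qed

context ranked
begin

lemma ranked_restrict_space:
  assumes S: "S \<in> sets M"
  shows "ranked (restrict_space M S) Y R"
proof (intro ranked.intro ranked_axioms.intro)
  show "finite_measure (restrict_space M S)"
    using S by (intro finite_measureI)
      (simp add: space_restrict_space emeasure_restrict_space emeasure_eq_measure)
  show "integrable (restrict_space M S) Y"
    using S integrable_mult_indicator[OF S integrable_Y] by (simp add: integrable_restrict_space)
  show "R \<in> borel_measurable (restrict_space M S)"
    by (rule measurable_restrict_space1) measurable
  fix r
  have "measure (restrict_space M S) {\<omega>\<in>space (restrict_space M S). R \<omega> = r} \<le> measure M {\<omega>\<in>space M. R \<omega> = r}"
    using S sets.sets_into_space[OF S]
    by (subst measure_restrict_space) (auto simp: space_restrict_space intro!: finite_measure_mono)
  then show "measure (restrict_space M S) {\<omega>\<in>space (restrict_space M S). R \<omega> = r} = 0"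
    using level_R[of r] measure_nonneg[of "restrict_space M S" "{\<omega>\<in>space (restrict_space M S). R \<omega> = r}"]
    by simp
qed (use monotone_R in \<open>auto simp: space_restrict_space\<close>)

text \<open>For calls and puts alike, the atom \<open>C\<close> contributes at most as much as all
  of \<open>T\<close>, and \<open>T\<close> at most as much as \<open>S\<close>; these are the
  hypotheses of \<open>select_order_interval\<close> on \<open>S\<close>.\<close>

lemma extract_atom:
  assumes "finite_measure N" and Z: "integrable N Z" and S: "S \<in> sets M" and T: "T \<in> sets N"
    and dom: "dominates M Y S N Z T" and C: "C \<in> sets N" "C \<subseteq> T" "\<And>\<omega>. \<omega> \<in> C \<Longrightarrow> Z \<omega> = c"
  obtains A where "A \<in> sets M" "A \<subseteq> S" "measure M A = measure N C"
    "(LINT \<omega>:A|M. Y \<omega>) = c * measure N C" "dominates M Y (S - A) N Z (T - C)"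
proof -
  interpret N: finite_measure N by fact
  define p where "p = measure N C"
  have meanC: "(LINT \<omega>:C|N. Z \<omega>) = c * p"
  proof -
    have "(LINT \<omega>:C|N. Z \<omega>) = (LINT \<omega>:C|N. c)"
      using C by (intro set_integral_eqI) auto
    then show ?thesis
      using C by (simp add: set_integral_const p_def)
  qed
  have pS: "p \<le> measure M S"
    using N.finite_measure_mono[OF C(2) T] dom by (simp add: p_def dominates_def)
  have callC: "max 0 (p * (c - k)) \<le> call N Z C k" for k
    using N.call_Jensen[OF Z C(1), of k] by (simp add: meanC p_def algebra_simps)
  have callTC: "call N Z (T - C) k = call N Z T k - call N Z C k" for k
    using C T Z by (simp add: N.call_Diff)
  have eTC: "(LINT \<omega>:T - C|N. Z \<omega>) = (LINT \<omega>:T|N. Z \<omega>) - c * p"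
    using C T Z by (simp add: N.set_integral_Diff meanC)
  have mTC: "measure N (T - C) = measure N T - p"
    using C T by (simp add: p_def N.finite_measure_Diff)
  have [measurable]: "Z \<in> borel_measurable N"
    using Z by simp
  have "0 \<le> p"
    by (simp add: p_def)
  \<comment> \<open>The window needs a mass strictly between 0 and that of \<open>S\<close>. An atom
    of mass 0 gets the empty set; one of full mass gets \<open>S\<close>, where \<open>Y\<close> has
    mean \<open>c\<close> because \<open>T - C\<close> is null.\<close>
  then consider "p = 0" | "0 < p" "p < measure M S" | "p = measure M S"
    using pS by linarith
  then show thesis
  proof cases
    case 1
    have "dominates M Y S N Z (T - C)"
      using dom mTC eTC callTC N.call_nonneg[of Z C]
      by (auto simp: dominates_def 1) (smt (verit))
    then show thesis
      using 1 by (intro that[of "{}"]) (auto simp: p_def)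
  next
    case 2
    interpret S: ranked "restrict_space M S" Y R
      by (rule ranked_restrict_space[OF S])
    have int_S: "(\<integral>\<omega>. f \<omega> \<partial>restrict_space M S) = (LINT \<omega>:S|M. f \<omega>)" for f :: "'a \<Rightarrow> real"
      using S by (simp add: integral_restrict_space set_lebesgue_integral_def)
    have setD: "X \<in> sets M \<and> X \<subseteq> S" if "X \<in> sets (restrict_space M S)" for X
      using that S by (simp add: sets_restrict_space_iff)
    have space_S: "space (restrict_space M S) = S"
      using sets.sets_into_space[OF S] by (auto simp: space_restrict_space)
    have measure_S: "measure (restrict_space M S) X = measure M X" if "X \<subseteq> S" for X
      using S that by (simp add: measure_restrict_space)
    have "p < measure (restrict_space M S) (space (restrict_space M S))"
      using 2 by (simp add: space_S measure_S)
    moreover have "p * (c - k) \<le> (\<integral>\<omega>. max 0 (Y \<omega> - k) \<partial>restrict_space M S)" for k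
    proof -
      have "p * (c - k) \<le> call N Z T k"
        using callC[of k] N.call_nonneg[of Z "T - C" k] by (simp add: callTC)
      also have "\<dots> \<le> call M Y S k"
        using dom by (simp add: dominates_def)
      finally show ?thesis
        by (simp add: int_S call_def)
    qed
    moreover have "p * (k - c) \<le> (\<integral>\<omega>. max 0 (k - Y \<omega>) \<partial>restrict_space M S)" for k
    proof -
      have "0 \<le> (LINT \<omega>:T - C|N. max 0 (k - Z \<omega>))"
        by (rule set_integral_nonneg_of_nonneg) simp
      then have "(LINT \<omega>:T|N. Z \<omega>) - c * p - k * (measure N T - p) \<le> call N Z T k - call N Z C k"
        using T C Z by (simp add: N.call_put_parity[of Z "T - C"] eTC mTC callTC)
      then have "p * (k - c) \<le> call N Z T k - ((LINT \<omega>:T|N. Z \<omega>) - k * measure N T)"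
        using callC[of k] by (simp add: algebra_simps)
      also have "\<dots> \<le> call M Y S k - ((LINT \<omega>:S|M. Y \<omega>) - k * measure M S)"
        using dom by (simp add: dominates_def)
      finally show ?thesis
        using call_put_parity[OF integrable_Y S] by (simp add: int_S)
    qed
    ultimately obtain L A H where LAH:
      "L \<in> sets (restrict_space M S)" "A \<in> sets (restrict_space M S)" "H \<in> sets (restrict_space M S)"
      "space (restrict_space M S) = L \<union> A \<union> H" "L \<inter> A = {}" "L \<inter> H = {}" "A \<inter> H = {}"
      "measure (restrict_space M S) A = p" "(LINT \<omega>:A|restrict_space M S. Y \<omega>) = c * p"
      "\<And>\<omega> \<omega>'. \<omega> \<in> L \<Longrightarrow> \<omega>' \<in> A \<union> H \<Longrightarrow> Y \<omega> \<le> Y \<omega>'"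
      "\<And>\<omega> \<omega>'. \<omega> \<in> A \<Longrightarrow> \<omega>' \<in> H \<Longrightarrow> Y \<omega> \<le> Y \<omega>'"
      by (rule S.select_order_interval[OF 2(1)]) (rule that)
    have SLAH: "S = L \<union> A \<union> H"
      using LAH(4) space_S by simp
    have mA: "measure M A = p"
      using LAH(2,8) setD measure_S by simp
    have "(LINT \<omega>:A|restrict_space M S. Y \<omega>) = (LINT \<omega>:S|M. indicator A \<omega> * Y \<omega>)"
      by (simp add: set_lebesgue_integral_def[of _ A] int_S)
    also have "\<dots> = (LINT \<omega>:A|M. Y \<omega>)"
      unfolding set_lebesgue_integral_def using SLAH
      by (intro Bochner_Integration.integral_cong) (auto simp: indicator_def)
    finally have eA: "(LINT \<omega>:A|M. Y \<omega>) = c * p"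
      using LAH(9) by simp
    have "L \<union> H \<noteq> {}"
      using SLAH mA 2 by auto
    then have "dominates M Y (L \<union> H) N Z (T - C)"
      using LAH setD mA eA dom C T
      by (intro dominates_remove_order_interval[OF finite_measure_axioms \<open>finite_measure N\<close> integrable_Y Z])
        (auto simp: p_def SLAH)
    moreover have "L \<union> H = S - A"
      using SLAH LAH(5-7) by auto
    ultimately show thesis
      using mA eA setD[OF LAH(2)] by (intro that[of A]) (auto simp: p_def)
  next
    case 3
    then have null: "measure N (T - C) = 0"
      using mTC dom by (simp add: dominates_def)
    have "(LINT \<omega>:T - C|N. Z \<omega>) = 0" "call N Z (T - C) k = 0" for k
      unfolding call_def using C T null by (auto intro!: N.set_integral_measure_zero)
    then show thesis
      using 3 S dom eTC null by (intro that[of S]) (auto simp: dominates_def p_def call_def)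
  qed
qed

end

section \<open>Atomless spaces\<close>

text \<open>Dynkin's argument for the signed measure with density \<open>f\<close>, pushed forward
  by \<open>V\<close>: the half-lines are a generator stable under intersection, and the total
  integral 0 settles complements.\<close>

lemma (in finite_measure) set_integral_vimage_eq_0:
  fixes f :: "'a \<Rightarrow> real" and V :: "'a \<Rightarrow> real"
  assumes f: "integrable M f" and f0: "(\<integral>\<omega>. f \<omega> \<partial>M) = 0" and [measurable]: "V \<in> borel_measurable M"
    and le: "\<And>v. (LINT \<omega>:{\<omega>\<in>space M. V \<omega> \<le> v}|M. f \<omega>) = 0"
    and B: "B \<in> sets borel"
  shows "(LINT \<omega>:{\<omega>\<in>space M. V \<omega> \<in> B}|M. f \<omega>) = 0"
proof -
  let ?G = "range (\<lambda>v::real. {..v})"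
  have borel: "sets borel = sigma_sets UNIV ?G"
    by (subst borel_eq_atMost) (simp add: sets_measure_of)
  have "Int_stable ?G"
    by (auto simp: Int_stable_def)
  moreover have "?G \<subseteq> Pow UNIV"
    by auto
  moreover have "B \<in> sigma_sets UNIV ?G"
    using B borel by simp
  ultimately show ?thesis
  proof (induction rule: sigma_sets_induct_disjoint)
    case (basic A)
    then show ?case using le by auto
  next
    case empty
    then show ?case by simp
  next
    case (compl A)
    then have [measurable]: "A \<in> sets borel"
      using borel by simp
    have "{\<omega>\<in>space M. V \<omega> \<in> UNIV - A} = space M - {\<omega>\<in>space M. V \<omega> \<in> A}"
      by auto
    moreover have "(LINT \<omega>:space M - {\<omega>\<in>space M. V \<omega> \<in> A}|M. f \<omega>)
        = (LINT \<omega>:space M|M. f \<omega>) - (LINT \<omega>:{\<omega>\<in>space M. V \<omega> \<in> A}|M. f \<omega>)"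
      by (rule set_integral_Diff[OF f]) auto
    ultimately show ?case
      using compl f f0 by (simp add: set_integral_space)
  next
    case (union A)
    then have [measurable]: "A i \<in> sets borel" for i
      using borel by auto
    have "{\<omega>\<in>space M. V \<omega> \<in> \<Union>(range A)} = (\<Union>i. {\<omega>\<in>space M. V \<omega> \<in> A i})"
      by auto
    moreover have "(LINT \<omega>:(\<Union>i. {\<omega>\<in>space M. V \<omega> \<in> A i})|M. f \<omega>) = (\<Sum>i. LINT \<omega>:{\<omega>\<in>space M. V \<omega> \<in> A i}|M. f \<omega>)"
    proof (rule lebesgue_integral_countable_add)
      show "set_integrable M (\<Union>i. {\<omega> \<in> space M. V \<omega> \<in> A i}) f"
        by (rule set_integrable_of_integrable[OF f]) auto
      show "{\<omega> \<in> space M. V \<omega> \<in> A i} \<inter> {\<omega> \<in> space M. V \<omega> \<in> A j} = {}" if "i \<noteq> j" for i j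
        using union(1) that by (auto simp: disjoint_family_on_def)
    qed auto
    ultimately show ?case
      using union by simp
  qed
qed

text \<open>
  Repeated splitting yields integer-valued \<open>K n\<close> with \<open>K (n + 1)\<close> equal to \<open>2 K n\<close> or
  \<open>2 K n + 1\<close>; the limit of \<open>K n / 2^n\<close> separates the cells up to the two neighbours.
\<close>

lemma (in finite_measure) exists_atomless_function:
  fixes f :: "'a \<Rightarrow> real"
  assumes f: "integrable M f" and f0: "(\<integral>\<omega>. f \<omega> \<partial>M) = 0"
    and split: "\<And>A. A \<in> sets M \<Longrightarrow> (LINT \<omega>:A|M. f \<omega>) = 0 \<Longrightarrow> 
      \<exists>B\<in>sets M. B \<subseteq> A \<and> (LINT \<omega>:B|M. f \<omega>) = 0 \<and>
        measure M B \<le> 2/3 * measure M A \<and> measure M (A - B) \<le> 2/3 * measure M A"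
  shows "\<exists>V. V \<in> borel_measurable M \<and> (\<forall>\<omega>\<in>space M. 0 \<le> V \<omega> \<and> V \<omega> \<le> (1::real)) \<and>
    (\<forall>v. measure M {\<omega>\<in>space M. V \<omega> = v} = 0) \<and>
    (\<forall>B\<in>sets borel. (LINT \<omega>:{\<omega>\<in>space M. V \<omega> \<in> B}|M. f \<omega>) = 0)"
proof -
  define m where "m = measure M (space M)"
  obtain sp where sp: "\<And>A. A \<in> sets M \<Longrightarrow> (LINT \<omega>:A|M. f \<omega>) = 0 \<Longrightarrow> 
      sp A \<in> sets M \<and> sp A \<subseteq> A \<and> (LINT \<omega>:sp A|M. f \<omega>) = 0 \<and>
        measure M (sp A) \<le> 2/3 * measure M A \<and> measure M (A - sp A) \<le> 2/3 * measure M A"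
    using split by metis
  \<comment> \<open>\<open>K n\<close> lists \<open>n\<close> binary digits; the next one tells
    whether a point lies in the chosen part of its current cell.\<close>
  define K where "K = rec_nat (\<lambda>_. 0::nat)
    (\<lambda>n k \<omega>. 2 * k \<omega> + (if \<omega> \<in> sp {\<omega>'\<in>space M. k \<omega>' = k \<omega>} then 1 else 0))"
  have K0: "K 0 \<omega> = 0" for \<omega>
    by (simp add: K_def)
  have KS: "K (Suc n) \<omega> = 2 * K n \<omega> + (if \<omega> \<in> sp {\<omega>'\<in>space M. K n \<omega>' = K n \<omega>} then 1 else 0)" for n \<omega>
    by (simp add: K_def)
  have cell: "{\<omega>\<in>space M. K n \<omega> = k} \<in> sets M \<and> (LINT \<omega>:{\<omega>\<in>space M. K n \<omega> = k}|M. f \<omega>) = 0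
      \<and> measure M {\<omega>\<in>space M. K n \<omega> = k} \<le> (2/3)^n * m" for n k
  proof (induction n arbitrary: k)
    case 0
    have "{\<omega>\<in>space M. K 0 \<omega> = k} = (if k = 0 then space M else {})"
      by (auto simp: K0)
    then show ?case
      using f f0 by (auto simp: m_def set_integral_space)
  next
    case (Suc n)
    \<comment> \<open>Dropping the last digit of \<open>k\<close> gives the parent cell; an odd
      \<open>k\<close> is its chosen part.\<close>
    define A where "A = {\<omega>\<in>space M. K n \<omega> = k div 2}"
    have A: "A \<in> sets M" "(LINT \<omega>:A|M. f \<omega>) = 0" "measure M A \<le> (2/3)^n * m"
      unfolding A_def using Suc by auto
    have spA: "sp A \<in> sets M" "sp A \<subseteq> A" "(LINT \<omega>:sp A|M. f \<omega>) = 0"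
        "measure M (sp A) \<le> 2/3 * measure M A" "measure M (A - sp A) \<le> 2/3 * measure M A"
      using sp[OF A(1,2)] by auto
    have "\<omega> \<in> {\<omega>\<in>space M. K (Suc n) \<omega> = k} \<longleftrightarrow> \<omega> \<in> (if odd k then sp A else A - sp A)" for \<omega>
    proof (cases "\<omega> \<in> A")
      case True
      then have "K (Suc n) \<omega> = 2 * (k div 2) + (if \<omega> \<in> sp A then 1 else 0)" "\<omega> \<in> space M"
        by (auto simp: KS A_def)
      then show ?thesis
        using True by (cases "odd k") (auto elim!: oddE evenE)
    next
      case False
      have "K (Suc n) \<omega> div 2 = K n \<omega>"
        by (simp add: KS)
      then show ?thesis
        using False spA(2) by (auto simp: A_def)
    qed
    then have eq: "{\<omega>\<in>space M. K (Suc n) \<omega> = k} = (if odd k then sp A else A - sp A)"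
      by blast
    show ?case
      unfolding eq using spA A by (auto simp: set_integral_Diff[OF f])
  qed
  have K_meas [measurable]: "K n \<in> measurable M (count_space UNIV)" for n
    using cell[of n] by (intro measurable_count_space_eq2_countable[THEN iffD2])
      (auto simp: vimage_def Int_def conj_commute)
  define V where "V \<omega> = lim (\<lambda>n. real (K n \<omega>) / 2^n)" for \<omega>
  have V: "(\<lambda>n. real (K n \<omega>) / 2^n) \<longlonglongrightarrow> V \<omega> \<and> (\<forall>n. real (K n \<omega>) / 2^n \<le> V \<omega>) \<and> (\<forall>n. V \<omega> \<le> (real (K n \<omega>) + 1) / 2^n)"
    for \<omega>
  proof -
    have lo: "incseq (\<lambda>n. real (K n \<omega>) / 2^n)"
      by (rule incseq_SucI) (auto simp: KS field_simps)
    have hi: "decseq (\<lambda>n. (real (K n \<omega>) + 1) / 2^n)"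
      by (rule decseq_SucI) (auto simp: KS field_simps)
    have "real (K n \<omega>) / 2^n \<le> 1" for n
    proof -
      have "real (K n \<omega>) / 2^n \<le> (real (K n \<omega>) + 1) / 2^n"
        by (simp add: divide_right_mono)
      also have "\<dots> \<le> (real (K 0 \<omega>) + 1) / 2^0"
        using hi by (simp only: decseq_def)
      finally show ?thesis by (simp add: K0)
    qed
    then obtain L where L: "(\<lambda>n. real (K n \<omega>) / 2^n) \<longlonglongrightarrow> L"
      by (rule incseq_convergent[OF lo, rule_format])
    have "(\<lambda>n. real (K n \<omega>) / 2^n + (1/2)^n) \<longlonglongrightarrow> L + 0"
      by (intro tendsto_add L LIMSEQ_realpow_zero) auto
    then have "(\<lambda>n. (real (K n \<omega>) + 1) / 2^n) \<longlonglongrightarrow> L"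
      by (simp add: add_divide_distrib power_divide)
    then have "L \<le> (real (K n \<omega>) + 1) / 2^n" for n
      using hi by (rule decseq_ge[rotated])
    then show ?thesis
      using L incseq_le[OF lo L] limI[OF L] by (simp add: V_def)
  qed
  have Vm [measurable]: "V \<in> borel_measurable M"
    by (rule borel_measurable_LIMSEQ_real[of _ "\<lambda>n \<omega>. real (K n \<omega>) / 2^n"]) (use V in auto)
  have level: "measure M {\<omega>\<in>space M. V \<omega> = v} = 0" for v
  proof (rule antisym)
    have "measure M {\<omega>\<in>space M. V \<omega> = v} \<le> 2 * ((2/3)^n * m)" for n
    proof -
      \<comment> \<open>\<open>v\<close> determines \<open>K n\<close> only up to one, as it may be
        the right end of its cell. For \<open>j = 0\<close> the truncated \<open>j - 1\<close>
        merely repeats the cell.\<close>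
      define j where "j = nat \<lfloor>2^n * v\<rfloor>"
      have "{\<omega>\<in>space M. V \<omega> = v} \<subseteq> {\<omega>\<in>space M. K n \<omega> = j} \<union> {\<omega>\<in>space M. K n \<omega> = j - 1}"
      proof
        fix \<omega> assume w: "\<omega> \<in> {\<omega>\<in>space M. V \<omega> = v}"
        then have "real (K n \<omega>) / 2^n \<le> v" "v \<le> (real (K n \<omega>) + 1) / 2^n"
          using V[of \<omega>] by auto
        then have "real (K n \<omega>) \<le> 2^n * v" "2^n * v \<le> real (K n \<omega>) + 1"
          by (auto simp: field_simps)
        then have "K n \<omega> \<le> j" "j \<le> K n \<omega> + 1"
          unfolding j_def by linarith+
        then have "K n \<omega> = j \<or> K n \<omega> = j - 1"
          by arith
        with w show "\<omega> \<in> {\<omega>\<in>space M. K n \<omega> = j} \<union> {\<omega>\<in>space M. K n \<omega> = j - 1}"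
          by auto
      qed
      then have "measure M {\<omega>\<in>space M. V \<omega> = v} \<le> measure M ({\<omega>\<in>space M. K n \<omega> = j} \<union> {\<omega>\<in>space M. K n \<omega> = j - 1})"
        by (rule finite_measure_mono) auto
      also have "\<dots> \<le> measure M {\<omega>\<in>space M. K n \<omega> = j} + measure M {\<omega>\<in>space M. K n \<omega> = j - 1}"
        by (rule measure_Un_le) auto
      also have "\<dots> \<le> 2 * ((2/3)^n * m)"
        using cell[of n j] cell[of n "j - 1"] by linarith
      finally show ?thesis .
    qed
    moreover have "(\<lambda>n. 2 * ((2/3)^n * m)) \<longlonglongrightarrow> 2 * (0 * m)"
      by (intro tendsto_intros LIMSEQ_realpow_zero) auto
    ultimately show "measure M {\<omega>\<in>space M. V \<omega> = v} \<le> 0"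
      by (intro LIMSEQ_le_const[of "\<lambda>n. 2 * ((2/3)^n * m)" "0"]) auto
  qed simp
  have finite_cells: "(LINT \<omega>:{\<omega>\<in>space M. K n \<omega> \<in> J}|M. f \<omega>) = 0" if "finite J" for n J
    using that
  proof induction
    case (insert k J)
    have "{\<omega>\<in>space M. K n \<omega> \<in> insert k J} = {\<omega>\<in>space M. K n \<omega> = k} \<union> {\<omega>\<in>space M. K n \<omega> \<in> J}"
      by auto
    then show ?case
      using insert cell[of n k] by (simp only:) (subst set_integral_split[OF f], auto)
  qed simp
  have le: "(LINT \<omega>:{\<omega>\<in>space M. V \<omega> \<le> v}|M. f \<omega>) = 0" for v
  proof -
    \<comment> \<open>The cells ending strictly left of \<open>v\<close> exhaust the set where
      \<open>V\<close> is less than \<open>v\<close>. Each stage is a finite union of cells, and the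
      level \<open>v\<close> itself is null.\<close>
    let ?C = "\<lambda>n. {\<omega>\<in>space M. (real (K n \<omega>) + 1) / 2^n < v}"
    have fin: "finite {k. (real k + 1) / 2^n < v}" for n
    proof (rule finite_subset)
      show "{k. (real k + 1) / 2^n < v} \<subseteq> {..nat \<lceil>2^n * v\<rceil>}"
      proof
        fix k assume "k \<in> {k. (real k + 1) / 2^n < v}"
        then have "real k \<le> 2^n * v" by (simp add: field_simps)
        then show "k \<in> {..nat \<lceil>2^n * v\<rceil>}" by simp linarith
      qed
    qed simp
    have cells: "(LINT \<omega>:?C n|M. f \<omega>) = 0" for n
      using finite_cells[OF fin, of n n] by simp
    have "(\<lambda>n. LINT \<omega>:?C n|M. f \<omega>) \<longlonglongrightarrow> (LINT \<omega>:(\<Union>n. ?C n)|M. f \<omega>)"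
    proof (rule set_integral_cont_up)
      have "(real (K (Suc n) \<omega>) + 1) / 2^Suc n \<le> (real (K n \<omega>) + 1) / 2^n" for n \<omega>
        by (auto simp: KS field_simps)
      then show "incseq ?C"
        by (intro incseq_SucI) (auto intro: le_less_trans)
      show "set_integrable M (\<Union>n. ?C n) f"
        by (rule set_integrable_of_integrable[OF f]) auto
    qed auto
    then have "(LINT \<omega>:(\<Union>n. ?C n)|M. f \<omega>) = 0"
      unfolding cells by (simp add: LIMSEQ_const_iff)
    also have "(\<Union>n. ?C n) = {\<omega>\<in>space M. V \<omega> < v}"
    proof safe
      fix n \<omega> assume "(real (K n \<omega>) + 1) / 2 ^ n < v"
      then show "V \<omega> < v"
        using V[of \<omega>] by (auto intro: le_less_trans)
    next
      fix \<omega> assume w: "\<omega> \<in> space M" "V \<omega> < v"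
      have "(\<lambda>n. real (K n \<omega>) / 2^n + (1/2)^n) \<longlonglongrightarrow> V \<omega> + 0"
        using V[of \<omega>] by (intro tendsto_add LIMSEQ_realpow_zero) auto
      then have "eventually (\<lambda>n. real (K n \<omega>) / 2^n + (1/2)^n < v) sequentially"
        using w by (intro order_tendstoD(2)) auto
      then obtain n where "real (K n \<omega>) / 2^n + (1/2)^n < v"
        by (auto simp: eventually_sequentially)
      then show "\<omega> \<in> (\<Union>n. ?C n)"
        using w by (auto simp: add_divide_distrib power_divide)
    qed
    finally have less: "(LINT \<omega>:{\<omega>\<in>space M. V \<omega> < v}|M. f \<omega>) = 0" .
    have "{\<omega>\<in>space M. V \<omega> \<le> v} = {\<omega>\<in>space M. V \<omega> < v} \<union> {\<omega>\<in>space M. V \<omega> = v}"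
      by auto
    moreover have "(LINT \<omega>:{\<omega>\<in>space M. V \<omega> < v} \<union> {\<omega>\<in>space M. V \<omega> = v}|M. f \<omega>) = 0"
      using f by (subst set_integral_split[OF f])
        (auto simp: less intro!: set_integral_measure_zero level)
    ultimately show ?thesis by simp
  qed
  have "0 \<le> V \<omega> \<and> V \<omega> \<le> 1" for \<omega>
  proof -
    have "real (K 0 \<omega>) / 2^0 \<le> V \<omega>" "V \<omega> \<le> (real (K 0 \<omega>) + 1) / 2^0"
      using V[of \<omega>] by blast+
    then show ?thesis
      by (simp add: K0)
  qed
  then show ?thesis
    using Vm level set_integral_vimage_eq_0[OF f f0 Vm le] by blast
qed

text \<open>Of a proper part and its complement, one has at most half the mass; iterate.\<close>

lemma (in finite_measure) atomless_small_subset: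
  assumes M: "atomless M" and A: "A \<in> sets M" "0 < measure M A" and e: "0 < (e::real)"
  obtains C where "C \<in> sets M" "C \<subseteq> A" "0 < measure M C" "measure M C < e"
proof -
  have half: "\<exists>B\<in>sets M. B \<subseteq> A \<and> 0 < measure M B \<and> measure M B \<le> measure M A / 2"
    if "A \<in> sets M" "0 < measure M A" for A
  proof -
    have "\<exists>B\<in>sets M. B \<subseteq> A \<and> 0 < emeasure M B \<and> emeasure M B < emeasure M A"
      using M that by (auto simp: atomless_def emeasure_eq_measure)
    then obtain B where B: "B \<in> sets M" "B \<subseteq> A" "0 < measure M B" "measure M B < measure M A"
      by (auto simp: emeasure_eq_measure ennreal_less_iff)
    have "measure M (A - B) = measure M A - measure M B"
      using B that by (simp add: finite_measure_Diff)
    then show ?thesis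
      using B that by (cases "measure M B \<le> measure M A / 2")
        (auto intro: bexI[of _ B] bexI[of _ "A - B"])
  qed
  have halves: "\<exists>C\<in>sets M. C \<subseteq> A \<and> 0 < measure M C \<and> measure M C \<le> measure M A * (1/2)^n" for n
  proof (induction n)
    case 0
    then show ?case using A by auto
  next
    case (Suc n)
    then obtain C where C: "C \<in> sets M" "C \<subseteq> A" "0 < measure M C" "measure M C \<le> measure M A * (1/2)^n"
      by blast
    with half[of C] obtain B where "B \<in> sets M" "B \<subseteq> C" "0 < measure M B" "measure M B \<le> measure M C / 2"
      by blast
    with C show ?case
      by (intro bexI[of _ B]) auto
  qed
  have "(\<lambda>n. measure M A * (1/2)^n) \<longlonglongrightarrow> measure M A * 0"
    by (intro tendsto_intros LIMSEQ_realpow_zero) auto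
  then have "eventually (\<lambda>n. measure M A * (1/2)^n < e) sequentially"
    using e by (intro order_tendstoD(2)) auto
  then obtain n where n: "measure M A * (1/2)^n < e"
    by (auto simp: eventually_sequentially)
  from halves[of n] obtain C where "C \<in> sets M" "C \<subseteq> A" "0 < measure M C"
    "measure M C \<le> measure M A * (1/2)^n"
    by blast
  with n show thesis
    by (intro that[of C]) auto
qed

text \<open>
  If no subset had measure between a third and two thirds, the subsets of measure less than a
  third would be closed under countable unions, so one of them would have the largest measure.
\<close>

lemma (in finite_measure) atomless_split_thirds:
  assumes M: "atomless M" and A: "A \<in> sets M"
  shows "\<exists>B\<in>sets M. B \<subseteq> A \<and> measure M B \<le> 2/3 * measure M A \<and> measure M (A - B) \<le> 2/3 * measure M A"
proof (rule ccontr)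
  assume not: "\<not> ?thesis"
  define a where "a = measure M A"
  have gap: "measure M B < a/3 \<or> 2/3 * a < measure M B" if "B \<in> sets M" "B \<subseteq> A" for B
  proof -
    have "measure M (A - B) = a - measure M B"
      using A that by (simp add: a_def finite_measure_Diff)
    with not that show ?thesis
      by (force simp: a_def not_le)
  qed
  have a: "0 < a"
    using gap[of A] A by (auto simp: a_def zero_less_measure_iff)
  define F where "F = {B\<in>sets M. B \<subseteq> A \<and> measure M B < a/3}"
  \<comment> \<open>Two such sets have a union of mass below two thirds, and the gap pushes it below
    one third.\<close>
  have Un: "B \<union> C \<in> F" if "B \<in> F" "C \<in> F" for B C
  proof -
    have "measure M (B \<union> C) \<le> measure M B + measure M C"
      using that by (intro measure_Un_le) (auto simp: F_def)
    then show ?thesis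
      using that gap[of "B \<union> C"] a by (auto simp: F_def)
  qed
  have bdd: "bdd_above (measure M ` F)"
    by (rule bdd_aboveI[of _ "a/3"]) (auto simp: F_def)
  have F_ne: "{} \<in> F"
    using a by (simp add: F_def)
  define s where "s = (SUP B\<in>F. measure M B)"
  have "\<exists>B\<in>F. s - 1 / real (Suc n) < measure M B" for n
    unfolding s_def using F_ne bdd by (subst less_cSUP_iff[symmetric]) auto
  then obtain B where B: "\<And>n. B n \<in> F" "\<And>n. s - 1 / real (Suc n) < measure M (B n)"
    by metis
  define U where "U = (\<Union>n. B n)"
  have partial: "(\<Union>i\<le>n. B i) \<in> F" for n
  proof (induction n)
    case (Suc n)
    then show ?case
      using Un[OF B(1)[of "Suc n"] Suc] by (simp add: atMost_Suc)
  qed (use B in simp)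
  have U: "U \<in> sets M" "U \<subseteq> A"
    using B(1) by (auto simp: U_def F_def)
  have "(\<lambda>n. measure M (\<Union>i\<le>n. B i)) \<longlonglongrightarrow> measure M (\<Union>n. \<Union>i\<le>n. B i)"
    using partial by (intro finite_Lim_measure_incseq) (auto simp: F_def incseq_def intro: order_trans)
  moreover have "(\<Union>n. \<Union>i\<le>n. B i) = U"
    by (auto simp: U_def)
  moreover have "measure M (\<Union>i\<le>n. B i) \<le> a/3" for n
    using partial[of n] by (simp add: F_def)
  ultimately have "measure M U \<le> a/3"
    by (intro LIMSEQ_le_const2[of _ "measure M U"]) auto
  then have "U \<in> F"
    using gap[OF U] U a by (auto simp: F_def)
  have "s \<le> measure M U"
  proof (rule field_le_epsilon)
    fix e :: real assume "0 < e"
    then obtain n where n: "1 / real (Suc n) < e"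
      using nat_approx_posE by blast
    have "measure M (B n) \<le> measure M U"
      using U by (intro finite_measure_mono) (auto simp: U_def)
    then show "s \<le> measure M U + e"
      using B(2)[of n] n by linarith
  qed
  have "measure M (A - U) = a - measure M U"
    using A U by (simp add: a_def finite_measure_Diff)
  then have "0 < measure M (A - U)"
    using \<open>measure M U \<le> a/3\<close> a by linarith
  \<comment> \<open>A small piece of the remaining mass can be added to \<open>U\<close> without
    leaving \<open>F\<close>, against the maximality of \<open>U\<close>.\<close>
  then obtain C where C: "C \<in> sets M" "C \<subseteq> A - U" "0 < measure M C" "measure M C < a/3"
    using atomless_small_subset[OF M, of "A - U" "a/3"] A U a by auto
  then have "U \<union> C \<in> F"
    using \<open>U \<in> F\<close> by (intro Un) (auto simp: F_def)
  then have "measure M (U \<union> C) \<le> s"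
    unfolding s_def using bdd by (rule cSUP_upper)
  moreover have "measure M (U \<union> C) = measure M U + measure M C"
    using C U by (intro finite_measure_Union) auto
  ultimately show False
    using C \<open>s \<le> measure M U\<close> by linarith
qed

text \<open>A distributional transform: \<open>V\<close> interpolates between the left limit and the
  value of the distribution function of \<open>Y\<close>, which resolves the atoms of
  \<open>Y\<close>; the summand \<open>Y\<close> makes the rank strictly increasing in
  \<open>Y\<close>. Here \<open>V\<close> only has to be atomless, so it is built from the density
  0.\<close>

lemma (in finite_measure) exists_ranked:
  fixes Y :: "'a \<Rightarrow> real"
  assumes M: "atomless M" and Y: "integrable M Y"
  obtains R where "ranked M Y R"
proof -
  have [measurable]: "Y \<in> borel_measurable M"
    using Y by simp
  have zero: "integrable M (\<lambda>_. 0::real)" "(\<integral>\<omega>. 0 \<partial>M) = (0::real)"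
    by simp_all
  have split: "\<exists>B\<in>sets M. B \<subseteq> A \<and> (LINT \<omega>:B|M. 0) = (0::real) \<and>
      measure M B \<le> 2/3 * measure M A \<and> measure M (A - B) \<le> 2/3 * measure M A"
    if "A \<in> sets M" for A
    using atomless_split_thirds[OF M that] by auto
  have "\<exists>V. V \<in> borel_measurable M \<and> (\<forall>\<omega>\<in>space M. 0 \<le> V \<omega> \<and> V \<omega> \<le> (1::real)) \<and>
    (\<forall>v. measure M {\<omega>\<in>space M. V \<omega> = v} = 0)"
    using exists_atomless_function[OF zero split] by blast
  then obtain V where V [measurable]: "V \<in> borel_measurable M"
    and V01': "\<forall>\<omega>\<in>space M. 0 \<le> V \<omega> \<and> V \<omega> \<le> (1::real)"
    and level': "\<forall>v. measure M {\<omega>\<in>space M. V \<omega> = v} = 0"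
    by blast
  note V01 = V01'[rule_format, THEN conjunct1] V01'[rule_format, THEN conjunct2] and level = level'[rule_format]
  define lt where "lt y = measure M {\<omega>\<in>space M. Y \<omega> < y}" for y
  define le where "le y = measure M {\<omega>\<in>space M. Y \<omega> \<le> y}" for y
  define R where "R \<omega> = Y \<omega> + ((1 - V \<omega>) * lt (Y \<omega>) + V \<omega> * le (Y \<omega>))" for \<omega>
  have [measurable]: "lt \<in> borel_measurable borel" "le \<in> borel_measurable borel"
    unfolding lt_def le_def
    by (auto intro!: borel_measurable_mono monoI finite_measure_mono)
  have lt_le: "lt y \<le> le y" for y
    unfolding lt_def le_def by (auto intro!: finite_measure_mono)
  have le_lt: "le y \<le> lt y'" if "y < y'" for y y'
    unfolding lt_def le_def using that by (auto intro!: finite_measure_mono)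
  have R_bounds: "Y \<omega> + lt (Y \<omega>) \<le> R \<omega>" "R \<omega> \<le> Y \<omega> + le (Y \<omega>)" if "\<omega> \<in> space M" for \<omega>
  proof -
    have "(1 - V \<omega>) * lt (Y \<omega>) + V \<omega> * lt (Y \<omega>) \<le> (1 - V \<omega>) * lt (Y \<omega>) + V \<omega> * le (Y \<omega>)"
      using V01[OF that] lt_le by (intro add_left_mono mult_left_mono) auto
    then show "Y \<omega> + lt (Y \<omega>) \<le> R \<omega>"
      by (simp add: R_def algebra_simps)
    have "(1 - V \<omega>) * lt (Y \<omega>) + V \<omega> * le (Y \<omega>) \<le> (1 - V \<omega>) * le (Y \<omega>) + V \<omega> * le (Y \<omega>)"
      using V01[OF that] lt_le by (intro add_right_mono mult_left_mono) auto
    then show "R \<omega> \<le> Y \<omega> + le (Y \<omega>)"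
      by (simp add: R_def algebra_simps)
  qed
  have mono: "R \<omega> < R \<omega>'" if "\<omega> \<in> space M" "\<omega>' \<in> space M" "Y \<omega> < Y \<omega>'" for \<omega> \<omega>'
    using R_bounds(2)[OF that(1)] R_bounds(1)[OF that(2)] le_lt[OF that(3)] that(3) by linarith
  have "measure M {\<omega>\<in>space M. R \<omega> = r} = 0" for r
  proof (cases "\<exists>\<omega>\<in>space M. R \<omega> = r")
    case False
    then have "{\<omega>\<in>space M. R \<omega> = r} = {}" by auto
    then show ?thesis by (simp only: measure_empty)
  next
    case True
    then obtain \<omega>0 where w0: "\<omega>0 \<in> space M" "R \<omega>0 = r" by blast
    have same: "Y \<omega> = Y \<omega>0" if "\<omega> \<in> space M" "R \<omega> = r" for \<omega>
      using mono[of \<omega> \<omega>0] mono[of \<omega>0 \<omega>] w0 that by (cases "Y \<omega>" "Y \<omega>0" rule: linorder_cases) auto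
    let ?y = "Y \<omega>0"
    \<comment> \<open>If \<open>?y\<close> is no atom of \<open>Y\<close>, the level lies in the
      null set where \<open>Y\<close> equals \<open>?y\<close>. If it is one, \<open>R\<close> is
      injective in \<open>V\<close> there, so the level lies in a level of \<open>V\<close>.\<close>
    have "measure M {\<omega>\<in>space M. R \<omega> = r} \<le> 0"
    proof (cases "lt ?y = le ?y")
      case True
      have "measure M {\<omega>\<in>space M. R \<omega> = r} \<le> measure M ({\<omega>\<in>space M. Y \<omega> \<le> ?y} - {\<omega>\<in>space M. Y \<omega> < ?y})"
        using same by (intro finite_measure_mono) auto
      also have "\<dots> = le ?y - lt ?y"
        unfolding le_def lt_def by (rule finite_measure_Diff) auto
      finally show ?thesis using True by simp
    next
      case False
      have "V \<omega> = V \<omega>0" if "\<omega> \<in> space M" "R \<omega> = r" for \<omega>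
      proof -
        have "R \<omega> = R \<omega>0" using that w0 by simp
        then have "(V \<omega> - V \<omega>0) * (le ?y - lt ?y) = 0"
          unfolding R_def same[OF that] by (simp add: algebra_simps)
        then show ?thesis using False by simp
      qed
      then have "measure M {\<omega>\<in>space M. R \<omega> = r} \<le> measure M {\<omega>\<in>space M. V \<omega> = V \<omega>0}"
        by (intro finite_measure_mono) auto
      then show ?thesis by (simp add: level)
    qed
    then show ?thesis
      using measure_nonneg[of M "{\<omega>\<in>space M. R \<omega> = r}"] by simp
  qed
  moreover have "R \<in> borel_measurable M"
    unfolding R_def[abs_def] by measurable
  ultimately have "ranked M Y R"
    using Y mono finite_measure_axioms by (intro ranked.intro ranked_axioms.intro) auto
  then show thesis by (rule that)
qed

lemma atomless_restrict_space:
  assumes M: "atomless M" and A: "A \<in> sets M"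
  shows "atomless (restrict_space M A)"
  unfolding atomless_def
proof (intro ballI impI)
  fix S assume "S \<in> sets (restrict_space M A)" "0 < emeasure (restrict_space M A) S"
  with A have S: "S \<in> sets M" "S \<subseteq> A" "0 < emeasure M S"
    by (auto simp: sets_restrict_space_iff emeasure_restrict_space)
  with M obtain B where "B \<in> sets M" "B \<subseteq> S" "0 < emeasure M B" "emeasure M B < emeasure M S"
    unfolding atomless_def by blast
  with A S show "\<exists>B\<in>sets (restrict_space M A). B \<subseteq> S \<and> 0 < emeasure (restrict_space M A) B \<and>
      emeasure (restrict_space M A) B < emeasure (restrict_space M A) S"
    by (intro bexI[of _ B]) (auto simp: sets_restrict_space_iff emeasure_restrict_space)
qed

section \<open>Prescribed laws with constant conditional mean\<close>

text \<open>On a set where \<open>Y\<close> has mean \<open>c\<close>, Jensen makes the constant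
  \<open>c\<close> dominated by \<open>Y\<close>. Take \<open>C\<close> and its complement in the
  set to have at most two thirds of the mass, and extract the atom that the constant forms on
  \<open>C\<close>: this gives a set of the same mass on which \<open>Y\<close> again has mean
  \<open>c\<close>, the split required for the density \<open>Y - c\<close>.\<close>

lemma (in ranked) exists_uncorrelated_atomless_function:
  assumes M: "atomless M" and mean: "(\<integral>\<omega>. Y \<omega> \<partial>M) = c * measure M (space M)"
  shows "\<exists>V. V \<in> borel_measurable M \<and> (\<forall>v::real. measure M {\<omega>\<in>space M. V \<omega> = v} = 0) \<and>
    (\<forall>B\<in>sets borel. (LINT \<omega>:{\<omega>\<in>space M. V \<omega> \<in> B}|M. Y \<omega> - c) = 0)"
proof -
  have f: "integrable M (\<lambda>\<omega>. Y \<omega> - c)"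
    using integrable_Y by simp
  have f0: "(\<integral>\<omega>. Y \<omega> - c \<partial>M) = 0"
    using integrable_Y mean by simp
  have split: "\<exists>B\<in>sets M. B \<subseteq> A \<and> (LINT \<omega>:B|M. Y \<omega> - c) = 0 \<and>
      measure M B \<le> 2/3 * measure M A \<and> measure M (A - B) \<le> 2/3 * measure M A"
    if A: "A \<in> sets M" "(LINT \<omega>:A|M. Y \<omega> - c) = 0" for A
  proof -
    obtain C where C: "C \<in> sets M" "C \<subseteq> A" "measure M C \<le> 2/3 * measure M A"
      "measure M (A - C) \<le> 2/3 * measure M A"
      using atomless_split_thirds[OF M A(1)] by blast
    have meanA: "(LINT \<omega>:A|M. Y \<omega>) = c * measure M A"
      using A by (simp add: set_integral_diff_const integrable_Y)
    have dom: "dominates M Y A M (\<lambda>_. c) A"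
    proof -
      have "call M (\<lambda>_. c) A k = max 0 ((LINT \<omega>:A|M. Y \<omega>) - k * measure M A)" for k
        using A(1) unfolding call_def meanA
        by (auto simp: set_integral_const left_diff_distrib[symmetric] max_def mult_le_0_iff
            zero_le_mult_iff intro: antisym)
      then show ?thesis
        using A call_Jensen[OF integrable_Y A(1)] by (simp add: dominates_def set_integral_const meanA)
    qed
    have const: "integrable M (\<lambda>_. c)"
      by simp
    obtain B where B: "B \<in> sets M" "B \<subseteq> A" "measure M B = measure M C"
      "(LINT \<omega>:B|M. Y \<omega>) = c * measure M C" "dominates M Y (A - B) M (\<lambda>_. c) (A - C)"
      by (rule extract_atom[OF finite_measure_axioms const A(1) A(1) dom C(1,2) refl])
    have "measure M (A - B) = measure M (A - C)"
      using A B C by (simp add: finite_measure_Diff)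
    with B C show ?thesis
      by (intro bexI[of _ B]) (auto simp: set_integral_diff_const integrable_Y)
  qed
  show ?thesis
    using exists_atomless_function[OF f f0 split] by blast
qed

text \<open>The rank function makes \<open>V\<close> uniform, and a quantile function turns uniform
  into any law. As \<open>g\<close> is a function of \<open>V\<close>, each event in
  \<open>g\<close> is one in \<open>V\<close> and inherits the mean \<open>c\<close>.\<close>

lemma (in ranked) exists_law_with_constant_mean:
  assumes M: "atomless M" and mean: "(\<integral>\<omega>. Y \<omega> \<partial>M) = c * measure M (space M)"
    and \<rho>: "finite_borel_measure \<rho>" and mass: "measure \<rho> UNIV = measure M (space M)"
  shows "\<exists>g\<in>borel_measurable M. \<forall>B\<in>sets borel. measure M {\<omega>\<in>space M. g \<omega> \<in> B} = measure \<rho> B \<and>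
    (LINT \<omega>:{\<omega>\<in>space M. g \<omega> \<in> B}|M. Y \<omega>) = c * measure \<rho> B"
proof (cases "measure M (space M) = 0")
  case True
  interpret \<rho>: finite_borel_measure \<rho> by fact
  have M0: "measure M A = 0" for A
    using True bounded_measure[of A] by (simp add: antisym)
  have R0: "measure \<rho> A = 0" for A
    using True mass \<rho>.bounded_measure[of A] by (simp add: antisym \<rho>.borel_UNIV)
  show ?thesis
    by (intro bexI[of _ "\<lambda>_. 0"] ballI conjI)
      (auto simp: M0 R0 intro!: set_integral_measure_zero)
next
  case False
  define m where "m = measure M (space M)"
  have m: "0 < m"
    using False by (simp add: m_def zero_less_measure_iff)
  interpret \<rho>: finite_borel_measure \<rho> by fact
  define \<rho>' where "\<rho>' = scale_measure (ennreal (1 / m)) \<rho>"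
  have measure_\<rho>': "measure \<rho>' A = measure \<rho> A / m" for A
    using m by (simp add: \<rho>'_def measure_def enn2real_mult)
  have sets_\<rho>': "sets \<rho>' = sets borel"
    by (simp add: \<rho>'_def \<rho>.M_is_borel)
  have "real_distribution \<rho>'"
  proof (intro real_distribution.intro real_distribution_axioms.intro prob_spaceI)
    have "emeasure \<rho>' (space \<rho>') = ennreal (1 / m) * ennreal m"
      by (simp add: \<rho>'_def space_scale_measure \<rho>.emeasure_eq_measure \<rho>.borel_UNIV mass m_def)
    then show "emeasure \<rho>' (space \<rho>') = 1"
      using m by (simp add: ennreal_mult[symmetric])
  qed (rule sets_\<rho>')
  then interpret Q: cdf_distribution \<rho>'
    by (rule cdf_distribution.intro)
  obtain V where V [measurable]: "V \<in> borel_measurable M"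
    and level: "\<forall>v::real. measure M {\<omega>\<in>space M. V \<omega> = v} = 0"
    and indep: "\<forall>B\<in>sets borel. (LINT \<omega>:{\<omega>\<in>space M. V \<omega> \<in> B}|M. Y \<omega> - c) = 0"
    using exists_uncorrelated_atomless_function[OF M mean] by blast
  obtain F where F: "mono F" "F \<in> borel_measurable borel"
    "\<And>t. 0 \<le> t \<Longrightarrow> t \<le> measure M (space M) \<Longrightarrow> measure M {\<omega>\<in>space M. F (V \<omega>) \<le> t} = t"
    using exists_uniform_rank[OF V] level by blast
  note [measurable] = F(2)
  \<comment> \<open>The quantile function \<open>Q.I\<close> is meaningful on the open unit
    interval; 0 is the default elsewhere, where the rescaled rank has no mass.\<close>
  define I where "I u = indicator {0<..<1} u *\<^sub>R Q.I u" for u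
  have [measurable]: "I \<in> borel_measurable borel"
    unfolding I_def[abs_def] using Q.measurable_CI by (subst (asm) borel_measurable_restrict_space_iff) auto
  define h where "h v = I (F v / m)" for v
  have [measurable]: "h \<in> borel_measurable borel"
    unfolding h_def[abs_def] by measurable
  define g where "g \<omega> = h (V \<omega>)" for \<omega>
  have [measurable]: "g \<in> borel_measurable M"
    unfolding g_def[abs_def] by measurable
  have inside: "AE \<omega> in M. 0 < F (V \<omega>) / m \<and> F (V \<omega>) / m < 1"
  proof -
    have "measure M (space M - {\<omega>\<in>space M. F (V \<omega>) \<le> m}) = 0"
      using F(3)[of m] m by (subst finite_measure_Diff) (auto simp: m_def)
    then have 1: "space M - {\<omega>\<in>space M. F (V \<omega>) \<le> m} \<in> null_sets M"
      by (auto simp: null_sets_def emeasure_eq_measure)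
    have 2: "{\<omega>\<in>space M. F (V \<omega>) = m} \<in> null_sets M"
      using F(3) m by (auto simp: m_def null_sets_def emeasure_eq_measure intro!: measure_level_eq_0)
    have 3: "{\<omega>\<in>space M. F (V \<omega>) \<le> 0} \<in> null_sets M"
      using F(3)[of 0] m by (auto simp: m_def null_sets_def emeasure_eq_measure)
    show ?thesis
      using AE_not_in[OF 1] AE_not_in[OF 2] AE_not_in[OF 3] AE_space
      by eventually_elim (use m in \<open>auto simp: field_simps\<close>)
  qed
  have law_le: "measure M {\<omega>\<in>space M. g \<omega> \<le> x} = measure \<rho> {..x}" for x
  proof -
    have C: "0 \<le> Q.C x" "Q.C x \<le> 1"
      by (simp_all add: Q.cdf_nonneg Q.cdf_bounded_prob)
    have "measure M {\<omega>\<in>space M. g \<omega> \<le> x} = measure M {\<omega>\<in>space M. F (V \<omega>) \<le> m * Q.C x}"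
    proof (rule measure_eq_AE)
      show "AE \<omega> in M. (\<omega> \<in> {\<omega>\<in>space M. g \<omega> \<le> x}) = (\<omega> \<in> {\<omega>\<in>space M. F (V \<omega>) \<le> m * Q.C x})"
        using inside
      proof eventually_elim
        case (elim \<omega>)
        then have "F (V \<omega>) / m \<le> Q.C x \<longleftrightarrow> g \<omega> \<le> x"
          using Q.pseudoinverse[of "F (V \<omega>) / m" x] by (simp add: g_def h_def I_def)
        then show ?case
          using m by (auto simp: field_simps)
      qed
    qed auto
    also have "\<dots> = m * Q.C x"
      using C m by (intro F(3)) (auto simp: m_def mult_left_le)
    also have "\<dots> = measure \<rho> {..x}"
      using m by (simp add: cdf_def measure_\<rho>')
    finally show ?thesis .
  qed
  have "distr M borel g = \<rho>"
  proof (rule cdf_unique')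
    show "finite_borel_measure (distr M borel g)"
      by (intro finite_borel_measure.intro finite_borel_measure_axioms.intro finite_measure_distr) auto
    show "cdf (distr M borel g) = cdf \<rho>"
    proof
      fix x
      have "cdf (distr M borel g) x = measure M {\<omega>\<in>space M. g \<omega> \<le> x}"
        unfolding cdf_def by (subst measure_distr) (auto intro!: arg_cong[where f="measure M"])
      then show "cdf (distr M borel g) x = cdf \<rho> x"
        by (simp add: law_le cdf_def)
    qed
  qed fact
  have law: "measure M {\<omega>\<in>space M. g \<omega> \<in> B} = measure \<rho> B" if [measurable]: "B \<in> sets borel" for B
  proof -
    have "measure M {\<omega>\<in>space M. g \<omega> \<in> B} = measure (distr M borel g) B"
      by (subst measure_distr) (auto intro!: arg_cong[where f="measure M"])
    then show ?thesis
      by (simp add: \<open>distr M borel g = \<rho>\<close>)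
  qed
  have "(LINT \<omega>:{\<omega>\<in>space M. g \<omega> \<in> B}|M. Y \<omega>) = c * measure \<rho> B" if [measurable]: "B \<in> sets borel" for B
  proof -
    have "h -` B \<in> sets borel"
      using measurable_sets[of h borel borel B] by simp
    then have "(LINT \<omega>:{\<omega>\<in>space M. V \<omega> \<in> h -` B}|M. Y \<omega> - c) = 0"
      using indep by blast
    then have "(LINT \<omega>:{\<omega>\<in>space M. g \<omega> \<in> B}|M. Y \<omega> - c) = 0"
      by (simp add: g_def)
    then show ?thesis
      using law[OF that] by (simp add: set_integral_diff_const integrable_Y)
  qed
  then show ?thesis
    using law by (intro bexI[of _ g]) auto
qed

lemma (in ranked) exists_law_with_constant_mean_on:
  assumes M: "atomless M" and A: "A \<in> sets M" and mean: "(LINT \<omega>:A|M. Y \<omega>) = c * measure M A"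
    and \<rho>: "finite_borel_measure \<rho>" and mass: "measure \<rho> UNIV = measure M A"
  shows "\<exists>g\<in>borel_measurable M. \<forall>B\<in>sets borel. measure M {\<omega>\<in>A. g \<omega> \<in> B} = measure \<rho> B \<and>
    (LINT \<omega>:{\<omega>\<in>A. g \<omega> \<in> B}|M. Y \<omega>) = c * measure \<rho> B"
proof -
  interpret A: ranked "restrict_space M A" Y R
    by (rule ranked_restrict_space[OF A])
  have space_A: "space (restrict_space M A) = A"
    using sets.sets_into_space[OF A] by (auto simp: space_restrict_space)
  have measure_A: "measure (restrict_space M A) X = measure M X" if "X \<subseteq> A" for X
    using A that by (simp add: measure_restrict_space)
  have "\<exists>g\<in>borel_measurable (restrict_space M A). \<forall>B\<in>sets borel.
      measure (restrict_space M A) {\<omega>\<in>space (restrict_space M A). g \<omega> \<in> B} = measure \<rho> B \<and>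
      (LINT \<omega>:{\<omega>\<in>space (restrict_space M A). g \<omega> \<in> B}|restrict_space M A. Y \<omega>) = c * measure \<rho> B"
    using A mean mass
    by (intro A.exists_law_with_constant_mean atomless_restrict_space M \<rho>)
      (auto simp: integral_restrict_space set_lebesgue_integral_def space_A measure_A)
  then obtain g where g: "g \<in> borel_measurable (restrict_space M A)"
    "\<And>B. B \<in> sets borel \<Longrightarrow> measure M {\<omega>\<in>A. g \<omega> \<in> B} = measure \<rho> B"
    "\<And>B. B \<in> sets borel \<Longrightarrow> (LINT \<omega>:{\<omega>\<in>A. g \<omega> \<in> B}|restrict_space M A. Y \<omega>) = c * measure \<rho> B"
    by (auto simp: space_A measure_A)
  define g' where "g' \<omega> = indicator A \<omega> *\<^sub>R g \<omega>" for \<omega>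
  have g': "g' \<in> borel_measurable M"
    unfolding g'_def[abs_def] using g(1) A by (subst (asm) borel_measurable_restrict_space_iff) auto
  have eq: "{\<omega>\<in>A. g' \<omega> \<in> B} = {\<omega>\<in>A. g \<omega> \<in> B}" for B
    by (auto simp: g'_def)
  have "(LINT \<omega>:{\<omega>\<in>A. g \<omega> \<in> B}|restrict_space M A. Y \<omega>) = (LINT \<omega>:{\<omega>\<in>A. g \<omega> \<in> B}|M. Y \<omega>)" for B
    using A unfolding set_lebesgue_integral_def
    by (subst integral_restrict_space) (auto intro!: Bochner_Integration.integral_cong simp: indicator_def)
  with g g' show ?thesis
    by (intro bexI[of _ g']) (auto simp: eq)
qed

section \<open>Call functions and laws\<close>

context finite_measure
begin

lemma measure_eq_set_integral: "A \<in> sets M \<Longrightarrow> measure M A = (LINT \<omega>:A|M. 1)"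
  by (simp add: set_integral_const)

lemma set_integral_countable_partition:
  fixes f :: "'a \<Rightarrow> real"
  assumes f: "integrable M f" and E: "\<And>j::nat. E j \<in> sets M" "E' \<in> sets M"
    and disj: "\<And>i j. i \<noteq> j \<Longrightarrow> E i \<inter> E j = {}" "\<And>j. E j \<inter> E' = {}"
  shows "(LINT \<omega>:(\<Union>j. E j) \<union> E'|M. f \<omega>) = (\<Sum>j. LINT \<omega>:E j|M. f \<omega>) + (LINT \<omega>:E'|M. f \<omega>)"
proof -
  have "(LINT \<omega>:(\<Union>j. E j) \<union> E'|M. f \<omega>) = (LINT \<omega>:(\<Union>j. E j)|M. f \<omega>) + (LINT \<omega>:E'|M. f \<omega>)"
    using E disj(2) by (intro set_integral_split[OF f]) blast+
  also have "(LINT \<omega>:(\<Union>j. E j)|M. f \<omega>) = (\<Sum>j. LINT \<omega>:E j|M. f \<omega>)"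
    using E disj by (intro lebesgue_integral_countable_add set_integrable_of_integrable[OF f]) auto
  finally show ?thesis .
qed

lemma call_lipschitz:
  assumes Y: "integrable M Y" and A: "A \<in> sets M"
  shows "(measure M A)-lipschitz_on UNIV (call M Y A)"
proof (rule lipschitz_onI)
  have *: "call M Y A k \<le> call M Y A k' + measure M A * \<bar>k - k'\<bar>" for k k'
  proof -
    have "call M Y A k \<le> (LINT \<omega>:A|M. max 0 (Y \<omega> - k') + \<bar>k - k'\<bar>)"
      unfolding call_def using Y A by (intro set_integral_leI) auto
    also have "\<dots> = call M Y A k' + measure M A * \<bar>k - k'\<bar>"
      unfolding call_def using Y A
      by (subst set_integral_add(2)) (auto intro!: set_integrable_of_integrable simp: set_integral_const)
    finally show ?thesis .
  qed
  show "dist (call M Y A k) (call M Y A k') \<le> measure M A * dist k k'" for k k'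
    using *[of k k'] *[of k' k] by (simp add: dist_real_def abs_le_iff abs_minus_commute)
qed simp

lemma continuous_on_call:
  assumes "integrable M Y" "A \<in> sets M"
  shows "continuous_on UNIV (call M Y A)"
  using call_lipschitz[OF assms] by (rule lipschitz_on_continuous_on)

lemma call_tendsto_0:
  assumes Y: "integrable M Y" and A: "A \<in> sets M" and e: "0 < e"
  shows "\<exists>K. \<forall>k\<ge>K. call M Y A k < e"
proof -
  have [measurable]: "Y \<in> borel_measurable M"
    using Y by simp
  have "(\<lambda>n. call M Y A (real n)) \<longlonglongrightarrow> (\<integral>\<omega>. 0 \<partial>M)"
    unfolding call_def set_lebesgue_integral_def
  proof (rule integral_dominated_convergence[where w="\<lambda>\<omega>. \<bar>Y \<omega>\<bar>"])
    show "AE \<omega> in M. (\<lambda>n. indicator A \<omega> *\<^sub>R max 0 (Y \<omega> - real n)) \<longlonglongrightarrow> 0"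
    proof (intro AE_I2 tendsto_eventually)
      fix \<omega>
      show "\<forall>\<^sub>F n in sequentially. indicator A \<omega> *\<^sub>R max 0 (Y \<omega> - real n) = 0"
        using eventually_ge_at_top[of "nat \<lceil>Y \<omega>\<rceil>"]
      proof eventually_elim
        case (elim n)
        then have "Y \<omega> \<le> real n" by linarith
        then show ?case by simp
      qed
    qed
  qed (use Y A in \<open>auto simp: indicator_def\<close>)
  then have "eventually (\<lambda>n. call M Y A (real n) < e) sequentially"
    using e by (intro order_tendstoD(2)) auto
  then obtain n where n: "call M Y A (real n) < e"
    by (auto simp: eventually_sequentially)
  have "call M Y A k < e" if "real n \<le> k" for k
    using call_antimono[OF Y A that] n by simp
  then show ?thesis by blast
qed

text \<open>The right derivative of a call function is minus the tail, so call functions determine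
  laws. The quotients of the payoff lie between 0 and 1 and eventually equal the indicator.\<close>

lemma call_difference_quotient:
  assumes Y: "integrable M Y" and S: "S \<in> sets M"
  shows "(\<lambda>n. real (Suc n) * (call M Y S k - call M Y S (k + 1 / real (Suc n)))) \<longlonglongrightarrow> measure M {\<omega>\<in>S. k < Y \<omega>}"
proof -
  have [measurable]: "Y \<in> borel_measurable M"
    using Y by simp
  let ?g = "\<lambda>n \<omega>. real (Suc n) * (max 0 (Y \<omega> - k) - max 0 (Y \<omega> - (k + 1 / real (Suc n))))"
  have g_int: "integrable M (?g n)" for n
    using Y by auto
  have "real (Suc n) * (call M Y S k - call M Y S (k + 1 / real (Suc n))) = (LINT \<omega>:S|M. ?g n \<omega>)" for n
    unfolding call_def using Y S
    by (subst set_integral_diff(2)[symmetric]) (auto intro!: set_integrable_of_integrable)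
  moreover have "(\<lambda>n. LINT \<omega>:S|M. ?g n \<omega>) \<longlonglongrightarrow> (\<integral>\<omega>. indicator {\<omega>\<in>S. k < Y \<omega>} \<omega> \<partial>M)"
    unfolding set_lebesgue_integral_def
  proof (rule integral_dominated_convergence[where w="\<lambda>\<omega>. 1"])
    have bounds: "0 \<le> ?g n \<omega> \<and> ?g n \<omega> \<le> 1" for n \<omega>
    proof -
      have "max 0 (y - k) - max 0 (y - (k + d)) \<le> d" if "0 \<le> d" for y d :: real
        using that by (auto simp: max_def)
      then have "max 0 (Y \<omega> - k) - max 0 (Y \<omega> - (k + 1 / real (Suc n))) \<le> 1 / real (Suc n)"
        by simp
      then have "?g n \<omega> \<le> real (Suc n) * (1 / real (Suc n))"
        by (intro mult_left_mono) auto
      moreover have "0 \<le> max 0 (y - k) - max 0 (y - (k + d))" if "0 \<le> d" for y d :: real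
        using that by (auto simp: max_def)
      then have "0 \<le> max 0 (Y \<omega> - k) - max 0 (Y \<omega> - (k + 1 / real (Suc n)))"
        by simp
      ultimately show ?thesis
        by (auto intro: mult_nonneg_nonneg)
    qed
    show "AE \<omega> in M. norm (indicator S \<omega> *\<^sub>R ?g n \<omega>) \<le> 1" for n
      using bounds by (auto simp: indicator_def simp del: of_nat_Suc)
    show "AE \<omega> in M. (\<lambda>n. indicator S \<omega> *\<^sub>R ?g n \<omega>) \<longlonglongrightarrow> indicator {\<omega>\<in>S. k < Y \<omega>} \<omega>"
    proof (intro AE_I2 tendsto_eventually)
      fix \<omega>
      show "\<forall>\<^sub>F n in sequentially. indicator S \<omega> *\<^sub>R ?g n \<omega> = indicator {\<omega>\<in>S. k < Y \<omega>} \<omega>"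
      proof (cases "k < Y \<omega>")
        case True
        then obtain m where m: "1 / real (Suc m) < Y \<omega> - k"
          using nat_approx_posE[of "Y \<omega> - k"] by auto
        show ?thesis
          using eventually_ge_at_top[of m]
        proof eventually_elim
          case (elim n)
          have "1 / real (Suc n) \<le> 1 / real (Suc m)"
            using elim by (intro divide_left_mono) auto
          then have "k + 1 / real (Suc n) \<le> Y \<omega>"
            using m by simp
          then have "?g n \<omega> = real (Suc n) * (1 / real (Suc n))"
            using True by (intro arg_cong2[where f="(*)"]) auto
          then show ?case
            using True by (simp add: indicator_def)
        qed
      next
        case False
        have "max 0 (Y \<omega> - (k + 1 / real (Suc n))) = 0" for n
        proof -
          have "0 \<le> 1 / real (Suc n)" by simp
          with False have "Y \<omega> - (k + 1 / real (Suc n)) \<le> 0" by linarith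
          then show ?thesis by simp
        qed
        moreover have "max 0 (Y \<omega> - k) = 0"
          using False by simp
        ultimately show ?thesis
          using False by (simp only:) (simp add: indicator_def)
      qed
    qed
    show "(\<lambda>\<omega>. indicator {\<omega>\<in>S. k < Y \<omega>} \<omega> :: real) \<in> borel_measurable M"
    proof -
      have "{\<omega>\<in>S. k < Y \<omega>} = S \<inter> {\<omega>\<in>space M. k < Y \<omega>}"
        using sets.sets_into_space[OF S] by auto
      then show ?thesis using S by simp
    qed
  qed (use S in auto)
  moreover have "(\<integral>\<omega>. indicator {\<omega>\<in>S. k < Y \<omega>} \<omega> \<partial>M) = measure M {\<omega>\<in>S. k < Y \<omega>}"
    using sets.sets_into_space[OF S] by (auto intro!: arg_cong[where f="measure M"])
  ultimately show ?thesis
    by simp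
qed

end

text \<open>
  Maximum principle: near a strike at which the calls differ, the dominated call function is
  affine and the dominating one convex, so the difference has no largest maximiser with a
  positive value; it vanishes at infinity.
\<close>

lemma dominates_imp_call_eq:
  assumes "finite_measure M" "finite_measure N" and Y: "integrable M Y" and Z: "integrable N Z"
    and S: "S \<in> sets M" and T: "T \<in> sets N" and dom: "dominates M Y S N Z T"
    and gap: "\<And>k. call N Z T k < call M Y S k \<Longrightarrow> \<exists>e>0. \<forall>\<omega>\<in>T. e \<le> \<bar>Z \<omega> - k\<bar>"
  shows "call M Y S k = call N Z T k"
proof (rule ccontr)
  interpret M: finite_measure M by fact
  interpret N: finite_measure N by fact
  define f where "f k = call M Y S k - call N Z T k" for k
  assume "call M Y S k \<noteq> call N Z T k"
  then have k: "0 < f k"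
    using dom by (auto simp: dominates_def f_def less_le)
  have cont: "continuous_on UNIV f"
    unfolding f_def[abs_def] by (intro continuous_on_diff M.continuous_on_call N.continuous_on_call Y Z S T)
  obtain K1 where K1: "\<And>x. K1 \<le> x \<Longrightarrow> f x < f k"
  proof -
    obtain K where "\<forall>x\<ge>K. call M Y S x < f k"
      using M.call_tendsto_0[OF Y S k] by blast
    then show thesis
      using N.call_nonneg[of Z T] by (intro that[of K]) (auto simp: f_def intro: le_less_trans[rotated])
  qed
  \<comment> \<open>Masses and means agree, so by parity the difference of calls is a difference of
    puts; a put of \<open>Y\<close> is a call of \<open>- Y\<close>, which vanishes at
    infinity.\<close>
  obtain K2 where K2: "\<And>x. x \<le> - K2 \<Longrightarrow> f x < f k"
  proof -
    have "integrable M (\<lambda>\<omega>. - Y \<omega>)"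
      using Y by simp
    then obtain K where K: "\<forall>x\<ge>K. call M (\<lambda>\<omega>. - Y \<omega>) S x < f k"
      using M.call_tendsto_0[OF _ S k] by blast
    have "f x < f k" if "x \<le> - K" for x
    proof -
      have "f x = (LINT \<omega>:S|M. max 0 (x - Y \<omega>)) - (LINT \<omega>:T|N. max 0 (x - Z \<omega>))"
        using dom by (simp add: f_def M.call_put_parity[OF Y S] N.call_put_parity[OF Z T] dominates_def)
      also have "\<dots> \<le> (LINT \<omega>:S|M. max 0 (x - Y \<omega>))"
        using set_integral_nonneg_of_nonneg[of T "\<lambda>\<omega>. max 0 (x - Z \<omega>)" N] by simp
      also have "\<dots> = call M (\<lambda>\<omega>. - Y \<omega>) S (- x)"
        by (simp add: call_def)
      also have "\<dots> < f k"
        using K that by simp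
      finally show ?thesis .
    qed
    then show thesis by (rule that)
  qed
  have cpt: "compact {x. c \<le> f x}" if "f k \<le> c" for c
  proof (rule compact_eq_bounded_closed[THEN iffD2], intro conjI)
    have "{x. c \<le> f x} \<subseteq> {- K2..K1}"
    proof
      fix x assume "x \<in> {x. c \<le> f x}"
      then have "\<not> f x < f k"
        using that by simp
      then show "x \<in> {- K2..K1}"
        using K1[of x] K2[of x] by (cases "K1 \<le> x"; cases "x \<le> - K2") auto
    qed
    then show "bounded {x. c \<le> f x}"
      by (rule bounded_subset[rotated]) simp
    show "closed {x. c \<le> f x}"
      using cont by (intro closed_Collect_le continuous_on_const)
  qed
  \<comment> \<open>\<open>x0\<close> is a maximiser and \<open>x1\<close> the largest one;
    compactness comes from the decay at both ends.\<close>
  obtain x0 where x0: "f k \<le> f x0" "\<And>x. f k \<le> f x \<Longrightarrow> f x \<le> f x0"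
    using continuous_attains_sup[OF cpt[OF order_refl] _ continuous_on_subset[OF cont subset_UNIV]] by auto
  obtain x1 where x1: "f x0 \<le> f x1" "\<And>x. f x0 \<le> f x \<Longrightarrow> x \<le> x1"
    using continuous_attains_sup[OF cpt[OF x0(1)] _ continuous_on_id] by auto
  have max: "f x \<le> f x1" for x
    using x0 x1 by (meson linear order_trans)
  have "0 < f x1"
    using k x0 x1 by linarith
  then obtain e where e: "0 < e" "\<And>\<omega>. \<omega> \<in> T \<Longrightarrow> e \<le> \<bar>Z \<omega> - x1\<bar>"
    using gap[of x1] by (auto simp: f_def)
  have "f (x1 + e) < f x0"
    using x1(2)[of "x1 + e"] e by (force simp: not_le[symmetric])
  then have less: "f (x1 + e) < f x1"
    using x1 by simp
  have "call M Y S x1 \<le> (call M Y S (x1 - e) + call M Y S (x1 + e)) / 2"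
    using M.call_convex[OF Y S, of "1/2" "x1 - e" "x1 + e"] by (simp add: field_simps)
  \<comment> \<open>No value of \<open>Z\<close> on \<open>T\<close> is closer than \<open>e\<close>
    to \<open>x1\<close>, so each payoff is affine in the strike from \<open>x1 - e\<close> to
    \<open>x1 + e\<close>.\<close>
  moreover have "call N Z T x1 = (call N Z T (x1 - e) + call N Z T (x1 + e)) / 2"
  proof -
    have "call N Z T x1 = (LINT \<omega>:T|N. (1/2) * max 0 (Z \<omega> - (x1 - e)) + (1/2) * max 0 (Z \<omega> - (x1 + e)))"
      unfolding call_def
    proof (rule set_integral_eqI)
      fix \<omega> assume "\<omega> \<in> T"
      then have "e \<le> \<bar>Z \<omega> - x1\<bar>"
        by (rule e(2))
      then show "max 0 (Z \<omega> - x1) = (1/2) * max 0 (Z \<omega> - (x1 - e)) + (1/2) * max 0 (Z \<omega> - (x1 + e))"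
        using e(1) by (cases "x1 \<le> Z \<omega>") (auto simp: max_def field_simps)
    qed
    also have "\<dots> = (1/2) * call N Z T (x1 - e) + (1/2) * call N Z T (x1 + e)"
      unfolding call_def using Z T
      by (subst set_integral_add(2)) (auto intro!: set_integrable_of_integrable)
    finally show ?thesis by simp
  qed
  ultimately have "f x1 \<le> (f (x1 - e) + f (x1 + e)) / 2"
    by (simp add: f_def)
  moreover have "False" if "c \<le> (a + b) / 2" "a \<le> c" "b < c" for a b c :: real
    using that by (simp add: field_simps)
  ultimately show False
    using max[of "x1 - e"] less by blast
qed

lemma distr_restrict_space_eqs:
  fixes f :: "'a \<Rightarrow> real"
  assumes "finite_measure M" and f [measurable]: "f \<in> borel_measurable M" and S: "S \<in> sets M"
  shows "finite_borel_measure (distr (restrict_space M S) borel f)"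
    and "B \<in> sets borel \<Longrightarrow> measure (distr (restrict_space M S) borel f) B = measure M {\<omega>\<in>S. f \<omega> \<in> B}"
    and "B \<in> sets borel \<Longrightarrow> (LINT y:B|distr (restrict_space M S) borel f. y) = (LINT \<omega>:{\<omega>\<in>S. f \<omega> \<in> B}|M. f \<omega>)"
proof -
  interpret M: finite_measure M by fact
  have space_S: "space (restrict_space M S) = S"
    using sets.sets_into_space[OF S] by (auto simp: space_restrict_space)
  have fS [measurable]: "f \<in> borel_measurable (restrict_space M S)"
    by (rule measurable_restrict_space1[OF f])
  interpret S: finite_measure "restrict_space M S"
    using S by (intro finite_measureI)
      (simp add: space_restrict_space emeasure_restrict_space M.emeasure_eq_measure)
  show "finite_borel_measure (distr (restrict_space M S) borel f)"
    by (intro finite_borel_measure.intro finite_borel_measure_axioms.intro S.finite_measure_distr) auto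
  assume B [measurable]: "B \<in> sets borel"
  have eq: "f -` B \<inter> S = {\<omega>\<in>S. f \<omega> \<in> B}"
    by auto
  show "measure (distr (restrict_space M S) borel f) B = measure M {\<omega>\<in>S. f \<omega> \<in> B}"
    using S by (subst measure_distr) (auto simp: space_S eq measure_restrict_space)
  have "(LINT y:B|distr (restrict_space M S) borel f. y) = (\<integral>\<omega>. indicator B (f \<omega>) *\<^sub>R f \<omega> \<partial>restrict_space M S)"
    unfolding set_lebesgue_integral_def by (intro integral_distr) auto
  also have "\<dots> = (LINT \<omega>:{\<omega>\<in>S. f \<omega> \<in> B}|M. f \<omega>)"
    using S unfolding set_lebesgue_integral_def
    by (subst integral_restrict_space) (auto intro!: Bochner_Integration.integral_cong simp: indicator_def)
  finally show "(LINT y:B|distr (restrict_space M S) borel f. y) = (LINT \<omega>:{\<omega>\<in>S. f \<omega> \<in> B}|M. f \<omega>)" .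
qed

lemma call_eq_imp_distr_eq:
  assumes "finite_measure M" "finite_measure N" and Y: "integrable M Y" and Z: "integrable N Z"
    and S: "S \<in> sets M" and T: "T \<in> sets N" and mass: "measure M S = measure N T"
    and call: "\<And>k. call M Y S k = call N Z T k"
  shows "distr (restrict_space M S) borel Y = distr (restrict_space N T) borel Z"
proof (rule cdf_unique')
  interpret M: finite_measure M by fact
  interpret N: finite_measure N by fact
  have [measurable]: "Y \<in> borel_measurable M" "Z \<in> borel_measurable N"
    using Y Z by auto
  show "finite_borel_measure (distr (restrict_space M S) borel Y)"
    "finite_borel_measure (distr (restrict_space N T) borel Z)"
    using S T by (auto intro!: distr_restrict_space_eqs(1) M.finite_measure_axioms N.finite_measure_axioms)
  show "cdf (distr (restrict_space M S) borel Y) = cdf (distr (restrict_space N T) borel Z)"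
  proof
    fix k
    have sub: "{\<omega>\<in>S. k < Y \<omega>} \<in> sets M" "{\<omega>\<in>T. k < Z \<omega>} \<in> sets N"
    proof -
      have "{\<omega>\<in>S. k < Y \<omega>} = S \<inter> {\<omega>\<in>space M. k < Y \<omega>}" "{\<omega>\<in>T. k < Z \<omega>} = T \<inter> {\<omega>\<in>space N. k < Z \<omega>}"
        using sets.sets_into_space[OF S] sets.sets_into_space[OF T] by auto
      then show "{\<omega>\<in>S. k < Y \<omega>} \<in> sets M" "{\<omega>\<in>T. k < Z \<omega>} \<in> sets N"
        using S T by simp_all
    qed
    have "measure M {\<omega>\<in>S. k < Y \<omega>} = measure N {\<omega>\<in>T. k < Z \<omega>}"
      using M.call_difference_quotient[OF Y S, of k] N.call_difference_quotient[OF Z T, of k]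
      unfolding call by (rule LIMSEQ_unique)
    moreover have "{\<omega>\<in>S. Y \<omega> \<le> k} = S - {\<omega>\<in>S. k < Y \<omega>}" "{\<omega>\<in>T. Z \<omega> \<le> k} = T - {\<omega>\<in>T. k < Z \<omega>}"
      by auto
    ultimately have "measure M {\<omega>\<in>S. Y \<omega> \<le> k} = measure N {\<omega>\<in>T. Z \<omega> \<le> k}"
      using S T sub mass by (simp add: M.finite_measure_Diff N.finite_measure_Diff)
    then show "cdf (distr (restrict_space M S) borel Y) k = cdf (distr (restrict_space N T) borel Z) k"
      using S T distr_restrict_space_eqs(2)[OF \<open>finite_measure M\<close>, of Y S "{..k}"]
        distr_restrict_space_eqs(2)[OF \<open>finite_measure N\<close>, of Z T "{..k}"] by (simp add: cdf_def)
  qed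
qed

section \<open>Embedding of the atoms and identification of the remainder\<close>

text \<open>On \<open>N\<close> the variable \<open>Z\<close> plays the role of \<open>Y\<close>;
  the law of \<open>X\<close> and the integrals of \<open>Z\<close> over events of \<open>X\<close>
  are copied to \<open>M\<close>. Rational values of \<open>Z\<close> are embedded as atoms. At
  irrational values the call functions touch, which the maximum principle exploits once the atoms
  are gone.\<close>

lemma (in ranked) exists_martingale_projection:
  fixes N :: "'b measure" and X Z :: "'b \<Rightarrow> real"
  assumes M: "atomless M" and N: "finite_measure N"
    and X: "X \<in> borel_measurable N" and Z: "integrable N Z"
    and dom: "dominates M Y (space M) N Z (space N)"
    and irrational: "\<And>\<omega>. \<omega> \<in> space N \<Longrightarrow> Z \<omega> \<notin> \<rat> \<Longrightarrow>
      X \<omega> = Z \<omega> \<and> call N Z (space N) (Z \<omega>) = call M Y (space M) (Z \<omega>)"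
  shows "\<exists>X'\<in>borel_measurable M. \<forall>B\<in>sets borel.
    measure M {\<omega>\<in>space M. X' \<omega> \<in> B} = measure N {\<omega>\<in>space N. X \<omega> \<in> B} \<and>
    (LINT \<omega>:{\<omega>\<in>space M. X' \<omega> \<in> B}|M. Y \<omega>) = (LINT \<omega>:{\<omega>\<in>space N. X \<omega> \<in> B}|N. Z \<omega>)"
proof -
  interpret N: finite_measure N by fact
  have Zm [measurable]: "Z \<in> borel_measurable N"
    using Z by simp
  note X [measurable]
  define q where "q = from_nat_into (\<rat> :: real set)"
  have q: "range q = \<rat>"
    unfolding q_def using countable_rat Rats_0 by (intro range_from_nat_into) auto
  \<comment> \<open>\<open>T n\<close> is what remains of \<open>N\<close> before the atom at
    \<open>q n\<close> is removed, so the atoms \<open>C n\<close> are disjoint by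
    construction.\<close>
  define T where "T n = {\<omega>\<in>space N. \<forall>i<n. Z \<omega> \<noteq> q i}" for n :: nat
  define C where "C n = {\<omega>\<in>T n. Z \<omega> = q n}" for n
  have T [measurable]: "T n \<in> sets N" for n
    unfolding T_def by measurable
  have C_alt: "C n = T n \<inter> {\<omega>\<in>space N. Z \<omega> = q n}" for n
    by (auto simp: C_def T_def)
  have C [measurable]: "C n \<in> sets N" for n
    unfolding C_alt by measurable
  have CT: "C n \<subseteq> T n" and CZ: "\<omega> \<in> C n \<Longrightarrow> Z \<omega> = q n" for n \<omega>
    by (auto simp: C_def)
  have T_Suc: "T (Suc n) = T n - C n" for n
    by (auto simp: T_def C_def less_Suc_eq)
  have T_0: "T 0 = space N"
    by (simp add: T_def)
  \<comment> \<open>Each remainder on \<open>M\<close> depends on all earlier choices, so the sets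
    are chosen recursively, with domination as the invariant.\<close>
  have "\<exists>S. \<forall>n. (S n \<in> sets M \<and> dominates M Y (S n) N Z (T n) \<and> (n = 0 \<longrightarrow> S n = space M)) \<and>
    (\<exists>A\<in>sets M. A \<subseteq> S n \<and> S (Suc n) = S n - A \<and> measure M A = measure N (C n) \<and>
      (LINT \<omega>:A|M. Y \<omega>) = q n * measure N (C n))"
  proof (rule dependent_nat_choice)
    show "\<exists>S. S \<in> sets M \<and> dominates M Y S N Z (T 0) \<and> (0 = 0 \<longrightarrow> S = space M)"
      using dom by (intro exI[of _ "space M"]) (simp add: T_0)
  next
    fix S n
    assume S: "S \<in> sets M \<and> dominates M Y S N Z (T n) \<and> (n = 0 \<longrightarrow> S = space M)"
    obtain A where "A \<in> sets M" "A \<subseteq> S" "measure M A = measure N (C n)"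
      "(LINT \<omega>:A|M. Y \<omega>) = q n * measure N (C n)" "dominates M Y (S - A) N Z (T n - C n)"
      by (rule extract_atom[OF N Z conjunct1[OF S] T conjunct1[OF conjunct2[OF S]] C CT CZ])
    then show "\<exists>S'. (S' \<in> sets M \<and> dominates M Y S' N Z (T (Suc n)) \<and> (Suc n = 0 \<longrightarrow> S' = space M)) \<and>
      (\<exists>A\<in>sets M. A \<subseteq> S \<and> S' = S - A \<and> measure M A = measure N (C n) \<and>
        (LINT \<omega>:A|M. Y \<omega>) = q n * measure N (C n))"
      using S by (intro exI[of _ "S - A"]) (auto simp: T_Suc)
  qed
  then obtain S where step: "\<forall>n. (S n \<in> sets M \<and> dominates M Y (S n) N Z (T n) \<and> (n = 0 \<longrightarrow> S n = space M)) \<and>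
    (\<exists>A\<in>sets M. A \<subseteq> S n \<and> S (Suc n) = S n - A \<and> measure M A = measure N (C n) \<and>
      (LINT \<omega>:A|M. Y \<omega>) = q n * measure N (C n))" ..
  then have S: "S n \<in> sets M" "dominates M Y (S n) N Z (T n)" "S 0 = space M" for n
    by auto
  have "\<exists>A. A \<in> sets M \<and> A \<subseteq> S n \<and> S (Suc n) = S n - A \<and> measure M A = measure N (C n) \<and>
      (LINT \<omega>:A|M. Y \<omega>) = q n * measure N (C n)" for n
    using step[THEN spec[of _ n]] unfolding Bex_def by (rule conjunct2)
  then have "\<exists>A. \<forall>n. A n \<in> sets M \<and> A n \<subseteq> S n \<and> S (Suc n) = S n - A n \<and> measure M (A n) = measure N (C n) \<and>
      (LINT \<omega>:A n|M. Y \<omega>) = q n * measure N (C n)"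
    by (intro choice allI)
  then obtain A where A': "\<forall>n. A n \<in> sets M \<and> A n \<subseteq> S n \<and> S (Suc n) = S n - A n \<and>
      measure M (A n) = measure N (C n) \<and> (LINT \<omega>:A n|M. Y \<omega>) = q n * measure N (C n)" ..
  then have A: "A n \<in> sets M" "A n \<subseteq> S n" "S (Suc n) = S n - A n"
    "measure M (A n) = measure N (C n)" "(LINT \<omega>:A n|M. Y \<omega>) = q n * measure N (C n)" for n
    by auto
  note [measurable] = S(1) A(1)
  have S_dec: "decseq S"
    by (rule decseq_SucI) (auto simp: A(3))
  have T_dec: "decseq T"
    by (rule decseq_SucI) (auto simp: T_Suc)
  have A_disj: "A i \<inter> A j = {}" if "i \<noteq> j" for i j
  proof -
    have "A i \<inter> A j = {}" if "i < j" for i j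
    proof -
      have "A j \<subseteq> S (Suc i)"
        using A(2)[of j] decseqD[OF S_dec, of "Suc i" j] that by auto
      then show ?thesis
        by (auto simp: A(3))
    qed
    then show ?thesis
      using that by (metis Int_commute linorder_neqE_nat)
  qed
  have C_disj: "C i \<inter> C j = {}" if "i \<noteq> j" for i j
    using that by (cases i j rule: linorder_cases) (auto simp: C_def T_def)
  define S' where "S' = (\<Inter>n. S n)"
  define T' where "T' = (\<Inter>n. T n)"
  have [measurable]: "S' \<in> sets M" "T' \<in> sets N"
    unfolding S'_def T'_def by auto
  have S'_alt: "S' = space M - (\<Union>n. A n)"
  proof -
    have "S n = space M - (\<Union>i<n. A i)" for n
      by (induction n) (auto simp: S(3) A(3) lessThan_Suc)
    then show ?thesis
      unfolding S'_def by auto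
  qed
  have T'_alt: "T' = {\<omega>\<in>space N. Z \<omega> \<notin> \<rat>}"
    unfolding T'_def T_def q[symmetric] by auto
  have C_T': "C n \<inter> T' = {}" for n
    using q by (auto simp: T'_alt C_def)
  have space_N: "space N = (\<Union>n. C n) \<union> T'"
  proof -
    have "\<omega> \<in> (\<Union>n. C n)" if "\<omega> \<in> space N" "Z \<omega> \<in> \<rat>" for \<omega>
    proof -
      define n where "n = (LEAST n. Z \<omega> = q n)"
      have ex: "\<exists>n. Z \<omega> = q n"
        using that q by auto
      then have "Z \<omega> = q n"
        unfolding n_def by (rule LeastI_ex)
      moreover have "Z \<omega> \<noteq> q i" if "i < n" for i
        using that unfolding n_def by (rule not_less_Least)
      ultimately have "\<omega> \<in> C n"
        using that by (auto simp: C_def T_def)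
      then show ?thesis by blast
    qed
    then show ?thesis
      using sets.sets_into_space[OF C] by (auto simp: T'_alt)
  qed
  have lim_M: "(\<lambda>n. LINT \<omega>:S n|M. f \<omega>) \<longlonglongrightarrow> (LINT \<omega>:S'|M. f \<omega>)" if "integrable M f" for f :: "'a \<Rightarrow> real"
    unfolding S'_def using S_dec set_integrable_of_integrable[OF that]
    by (intro set_integral_cont_down) auto
  have lim_N: "(\<lambda>n. LINT \<omega>:T n|N. f \<omega>) \<longlonglongrightarrow> (LINT \<omega>:T'|N. f \<omega>)" if "integrable N f" for f :: "'b \<Rightarrow> real"
    unfolding T'_def using T_dec set_integrable_of_integrable[OF that]
    by (intro set_integral_cont_down) auto
  have lim_call: "(\<lambda>n. call M Y (S n) k) \<longlonglongrightarrow> call M Y S' k" "(\<lambda>n. call N Z (T n) k) \<longlonglongrightarrow> call N Z T' k" for k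
    unfolding call_def using Z integrable_Y by (auto intro!: lim_M lim_N)
  have dom': "dominates M Y S' N Z T'"
    unfolding dominates_def
  proof (intro conjI allI)
    have "(\<lambda>n. measure M (S n)) \<longlonglongrightarrow> measure M S'"
      unfolding S'_def using S_dec by (intro finite_Lim_measure_decseq) auto
    moreover have "(\<lambda>n. measure N (T n)) \<longlonglongrightarrow> measure N T'"
      unfolding T'_def using T_dec by (intro N.finite_Lim_measure_decseq) auto
    moreover have "measure M (S n) = measure N (T n)" for n
      using S(2)[of n] by (simp only: dominates_def)
    ultimately show "measure M S' = measure N T'"
      by (simp only:) (rule LIMSEQ_unique)
    have "(LINT \<omega>:S n|M. Y \<omega>) = (LINT \<omega>:T n|N. Z \<omega>)" for n
      using S(2)[of n] by (simp only: dominates_def)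
    then show "(LINT \<omega>:S'|M. Y \<omega>) = (LINT \<omega>:T'|N. Z \<omega>)"
      using lim_M[OF integrable_Y] lim_N[OF Z] by (simp only:) (rule LIMSEQ_unique)
    show "call N Z T' k \<le> call M Y S' k" for k
      using S(2) by (intro LIMSEQ_le[OF lim_call(2,1)]) (auto simp: dominates_def)
  qed
  \<comment> \<open>Removing an atom together with its embedding never widens the gap between the
    call functions, since by Jensen the embedded set has the larger call. So strikes at which the
    calls touch initially remain such for the remainders.\<close>
  have diff_le: "call M Y S' k - call N Z T' k \<le> call M Y (space M) k - call N Z (space N) k" for k
  proof -
    have "call M Y (S n) k - call N Z (T n) k \<le> call M Y (space M) k - call N Z (space N) k" for n
    proof (induction n)
      case (Suc n)
      have "call N Z (C n) k = (LINT \<omega>:C n|N. max 0 (q n - k))"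
        unfolding call_def by (intro set_integral_eqI) (simp add: CZ)
      also have "\<dots> = max 0 (q n * measure N (C n) - k * measure N (C n))"
      proof (cases "q n \<le> k")
        case True
        then have "q n * measure N (C n) \<le> k * measure N (C n)"
          by (intro mult_right_mono) auto
        with True show ?thesis by simp
      next
        case False
        then have "k * measure N (C n) \<le> q n * measure N (C n)"
          by (intro mult_right_mono) auto
        with False show ?thesis
          using C by (simp add: set_integral_const algebra_simps)
      qed
      also have "\<dots> \<le> call M Y (A n) k"
        using call_Jensen[OF integrable_Y A(1), of n k] A(4,5) by simp
      finally have "call N Z (C n) k \<le> call M Y (A n) k" .
      then show ?case
        using Suc A(1-3) S(1) CT T C Z integrable_Y by (simp add: T_Suc call_Diff N.call_Diff)
    qed (simp add: S(3) T_0)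
    then show ?thesis
      by (intro LIMSEQ_le_const2[OF tendsto_diff[OF lim_call]]) auto
  qed
  have call_eq: "call M Y S' k = call N Z T' k" for k
  proof (rule dominates_imp_call_eq[OF finite_measure_axioms N integrable_Y Z _ _ dom'])
    fix k assume "call N Z T' k < call M Y S' k"
    then have k: "0 < call M Y (space M) k - call N Z (space N) k"
      using diff_le[of k] by linarith
    have "continuous_on UNIV (\<lambda>k. call M Y (space M) k - call N Z (space N) k)"
      by (intro continuous_on_diff continuous_on_call N.continuous_on_call integrable_Y Z) auto
    then have "open {k. 0 < call M Y (space M) k - call N Z (space N) k}"
      by (intro open_Collect_less continuous_on_const)
    \<comment> \<open>The strikes with a positive initial gap form an open set, which the irrational
      values of \<open>Z\<close> avoid.\<close>
    then obtain e where e: "0 < e" "\<And>x. dist x k < e \<Longrightarrow> 0 < call M Y (space M) x - call N Z (space N) x"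
      using k unfolding open_dist by auto
    have "e \<le> \<bar>Z \<omega> - k\<bar>" if "\<omega> \<in> T'" for \<omega>
    proof -
      have "call N Z (space N) (Z \<omega>) = call M Y (space M) (Z \<omega>)"
        using irrational[of \<omega>] that by (simp add: T'_alt)
      then have "\<not> dist (Z \<omega>) k < e"
        using e(2)[of "Z \<omega>"] by auto
      then show ?thesis
        by (simp add: dist_real_def)
    qed
    then show "\<exists>e>0. \<forall>\<omega>\<in>T'. e \<le> \<bar>Z \<omega> - k\<bar>"
      using e(1) by blast
  qed auto
  have mass': "measure M S' = measure N T'"
    using dom' by (simp add: dominates_def)
  have rest: "distr (restrict_space M S') borel Y = distr (restrict_space N T') borel Z"
    by (rule call_eq_imp_distr_eq[OF finite_measure_axioms N integrable_Y Z _ _ mass' call_eq]) auto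
  have "\<exists>g. g \<in> borel_measurable M \<and> (\<forall>B\<in>sets borel.
      measure M {\<omega>\<in>A n. g \<omega> \<in> B} = measure N {\<omega>\<in>C n. X \<omega> \<in> B} \<and>
      (LINT \<omega>:{\<omega>\<in>A n. g \<omega> \<in> B}|M. Y \<omega>) = q n * measure N {\<omega>\<in>C n. X \<omega> \<in> B})" for n
  proof -
    \<comment> \<open>The law to be realised on \<open>A n\<close> is that of \<open>X\<close>
      restricted to \<open>C n\<close>, which has the mass of \<open>A n\<close>.\<close>
    let ?\<rho> = "distr (restrict_space N (C n)) borel X"
    have "(LINT \<omega>:A n|M. Y \<omega>) = q n * measure M (A n)"
      using A(4,5) by simp
    moreover have "finite_borel_measure ?\<rho>"
      by (rule distr_restrict_space_eqs(1)[OF N X C])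
    moreover have "measure ?\<rho> UNIV = measure M (A n)"
      using distr_restrict_space_eqs(2)[OF N X C, of UNIV n] A(4) by simp
    ultimately have "\<exists>g\<in>borel_measurable M. \<forall>B\<in>sets borel. measure M {\<omega>\<in>A n. g \<omega> \<in> B} = measure ?\<rho> B \<and>
        (LINT \<omega>:{\<omega>\<in>A n. g \<omega> \<in> B}|M. Y \<omega>) = q n * measure ?\<rho> B"
      by (rule exists_law_with_constant_mean_on[OF M A(1)])
    then show ?thesis
      using distr_restrict_space_eqs(2)[OF N X C] by auto
  qed
  then have "\<exists>g. \<forall>n. g n \<in> borel_measurable M \<and> (\<forall>B\<in>sets borel.
      measure M {\<omega>\<in>A n. g n \<omega> \<in> B} = measure N {\<omega>\<in>C n. X \<omega> \<in> B} \<and>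
      (LINT \<omega>:{\<omega>\<in>A n. g n \<omega> \<in> B}|M. Y \<omega>) = q n * measure N {\<omega>\<in>C n. X \<omega> \<in> B})"
    by (intro choice allI)
  then obtain g where g': "\<forall>n. g n \<in> borel_measurable M \<and> (\<forall>B\<in>sets borel.
      measure M {\<omega>\<in>A n. g n \<omega> \<in> B} = measure N {\<omega>\<in>C n. X \<omega> \<in> B} \<and>
      (LINT \<omega>:{\<omega>\<in>A n. g n \<omega> \<in> B}|M. Y \<omega>) = q n * measure N {\<omega>\<in>C n. X \<omega> \<in> B})" ..
  then have g [measurable]: "g n \<in> borel_measurable M" for n
    by auto
  have g_law: "measure M {\<omega>\<in>A n. g n \<omega> \<in> B} = measure N {\<omega>\<in>C n. X \<omega> \<in> B}"
    and g_mean: "(LINT \<omega>:{\<omega>\<in>A n. g n \<omega> \<in> B}|M. Y \<omega>) = q n * measure N {\<omega>\<in>C n. X \<omega> \<in> B}"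
    if "B \<in> sets borel" for n B
    using g' that by auto
  \<comment> \<open>On the remainder \<open>Y\<close> already has the law of \<open>Z\<close>, and
    \<open>Z\<close> is \<open>X\<close> there.\<close>
  define X' where "X' \<omega> = (if \<exists>n. \<omega> \<in> A n then g (LEAST n. \<omega> \<in> A n) \<omega> else Y \<omega>)" for \<omega>
  have X'_A: "X' \<omega> = g n \<omega>" if "\<omega> \<in> A n" for n \<omega>
  proof -
    have uniq: "i = n" if "\<omega> \<in> A i" for i
      using A_disj[of i n] that \<open>\<omega> \<in> A n\<close> by blast
    have "(LEAST n. \<omega> \<in> A n) = n"
    proof (rule Least_equality)
      show "\<omega> \<in> A n" by (rule that)
      show "n \<le> i" if "\<omega> \<in> A i" for i
        using uniq[OF that] by simp
    qed
    moreover have "\<exists>n. \<omega> \<in> A n"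
      using that by blast
    ultimately show ?thesis
      by (simp only: X'_def if_True)
  qed
  have X'_S': "X' \<omega> = Y \<omega>" if "\<omega> \<in> S'" for \<omega>
  proof -
    have "\<not> (\<exists>n. \<omega> \<in> A n)"
      using that by (simp add: S'_alt)
    then show ?thesis
      by (simp only: X'_def if_False)
  qed
  have split_M: "{\<omega>\<in>space M. X' \<omega> \<in> B} = (\<Union>n. {\<omega>\<in>A n. g n \<omega> \<in> B}) \<union> {\<omega>\<in>S'. Y \<omega> \<in> B}" for B
  proof (rule set_eqI)
    fix \<omega>
    show "\<omega> \<in> {\<omega>\<in>space M. X' \<omega> \<in> B} \<longleftrightarrow> \<omega> \<in> (\<Union>n. {\<omega>\<in>A n. g n \<omega> \<in> B}) \<union> {\<omega>\<in>S'. Y \<omega> \<in> B}"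
    proof (cases "\<exists>n. \<omega> \<in> A n")
      case True
      then obtain n where n: "\<omega> \<in> A n" by blast
      then have "\<omega> \<in> space M" "\<omega> \<notin> S'"
        using sets.sets_into_space[OF A(1)] by (auto simp: S'_alt)
      then show ?thesis
        using n by (auto simp: X'_A[symmetric])
    next
      case False
      then have "\<omega> \<in> S' \<longleftrightarrow> \<omega> \<in> space M"
        by (simp add: S'_alt)
      with False show ?thesis
        using X'_S'[of \<omega>] by auto
    qed
  qed
  have split_N: "{\<omega>\<in>space N. X \<omega> \<in> B} = (\<Union>n. {\<omega>\<in>C n. X \<omega> \<in> B}) \<union> {\<omega>\<in>T'. X \<omega> \<in> B}" for B
    unfolding space_N by auto
  have meas_M: "{\<omega>\<in>A n. g n \<omega> \<in> B} \<in> sets M" "{\<omega>\<in>S'. Y \<omega> \<in> B} \<in> sets M" if [measurable]: "B \<in> sets borel" for n B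
  proof -
    have "{\<omega>\<in>A n. g n \<omega> \<in> B} = A n \<inter> {\<omega>\<in>space M. g n \<omega> \<in> B}" "{\<omega>\<in>S'. Y \<omega> \<in> B} = S' \<inter> {\<omega>\<in>space M. Y \<omega> \<in> B}"
      using sets.sets_into_space[OF A(1)] by (auto simp: S'_alt)
    then show "{\<omega>\<in>A n. g n \<omega> \<in> B} \<in> sets M" "{\<omega>\<in>S'. Y \<omega> \<in> B} \<in> sets M"
      by simp_all
  qed
  have meas_N: "{\<omega>\<in>C n. X \<omega> \<in> B} \<in> sets N" "{\<omega>\<in>T'. X \<omega> \<in> B} \<in> sets N" if [measurable]: "B \<in> sets borel" for n B
  proof -
    have "{\<omega>\<in>C n. X \<omega> \<in> B} = C n \<inter> {\<omega>\<in>space N. X \<omega> \<in> B}" "{\<omega>\<in>T'. X \<omega> \<in> B} = T' \<inter> {\<omega>\<in>space N. X \<omega> \<in> B}"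
      using sets.sets_into_space[OF C] by (auto simp: T'_alt)
    then show "{\<omega>\<in>C n. X \<omega> \<in> B} \<in> sets N" "{\<omega>\<in>T'. X \<omega> \<in> B} \<in> sets N"
      by simp_all
  qed
  have XZ: "{\<omega>\<in>T'. X \<omega> \<in> B} = {\<omega>\<in>T'. Z \<omega> \<in> B}" for B
    using irrational by (auto simp: T'_alt)
  have law_rest: "measure M {\<omega>\<in>S'. Y \<omega> \<in> B} = measure N {\<omega>\<in>T'. X \<omega> \<in> B}"
    and mean_rest: "(LINT \<omega>:{\<omega>\<in>S'. Y \<omega> \<in> B}|M. Y \<omega>) = (LINT \<omega>:{\<omega>\<in>T'. X \<omega> \<in> B}|N. Z \<omega>)"
    if "B \<in> sets borel" for B
    using distr_restrict_space_eqs(2,3)[OF finite_measure_axioms measurable_Y _ that, of S']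
      distr_restrict_space_eqs(2,3)[OF N Zm _ that, of T'] rest by (simp_all add: XZ)
  have mean_C: "(LINT \<omega>:{\<omega>\<in>C n. X \<omega> \<in> B}|N. Z \<omega>) = q n * measure N {\<omega>\<in>C n. X \<omega> \<in> B}" if "B \<in> sets borel" for n B
  proof -
    have "(LINT \<omega>:{\<omega>\<in>C n. X \<omega> \<in> B}|N. Z \<omega>) = (LINT \<omega>:{\<omega>\<in>C n. X \<omega> \<in> B}|N. q n)"
      by (intro set_integral_eqI) (simp add: CZ)
    then show ?thesis
      using meas_N[OF that] by (simp add: set_integral_const)
  qed
  have sum_M: "(LINT \<omega>:{\<omega>\<in>space M. X' \<omega> \<in> B}|M. f \<omega>) =
      (\<Sum>n. LINT \<omega>:{\<omega>\<in>A n. g n \<omega> \<in> B}|M. f \<omega>) + (LINT \<omega>:{\<omega>\<in>S'. Y \<omega> \<in> B}|M. f \<omega>)"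
    if "B \<in> sets borel" "integrable M f" for B and f :: "'a \<Rightarrow> real"
    unfolding split_M using that meas_M A_disj
    by (intro set_integral_countable_partition) (auto simp: S'_alt disjoint_iff)
  have sum_N: "(LINT \<omega>:{\<omega>\<in>space N. X \<omega> \<in> B}|N. f \<omega>) =
      (\<Sum>n. LINT \<omega>:{\<omega>\<in>C n. X \<omega> \<in> B}|N. f \<omega>) + (LINT \<omega>:{\<omega>\<in>T'. X \<omega> \<in> B}|N. f \<omega>)"
    if "B \<in> sets borel" "integrable N f" for B and f :: "'b \<Rightarrow> real"
    unfolding split_N using that meas_N C_disj C_T'
    by (intro N.set_integral_countable_partition) (auto simp: disjoint_iff)
  have X'_meas: "X' \<in> borel_measurable M"
  proof (rule measurableI)
    fix B :: "real set" assume "B \<in> sets borel"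
    then have "{\<omega>\<in>space M. X' \<omega> \<in> B} \<in> sets M"
      unfolding split_M using meas_M by (intro sets.Un sets.countable_UN) auto
    then show "X' -` B \<inter> space M \<in> sets M"
      by (simp add: vimage_def Int_def conj_commute)
  qed simp
  show ?thesis
  proof (intro bexI[OF _ X'_meas] ballI conjI)
    fix B :: "real set" assume B: "B \<in> sets borel"
    have XB: "{\<omega>\<in>space N. X \<omega> \<in> B} \<in> sets N" and X'B: "{\<omega>\<in>space M. X' \<omega> \<in> B} \<in> sets M"
      using B X'_meas by auto
    \<comment> \<open>Masses are written as integrals of 1, so that one partition formula gives both
      the law and the means.\<close>
    have eqs: "(LINT \<omega>:{\<omega>\<in>A n. g n \<omega> \<in> B}|M. (1::real)) = (LINT \<omega>:{\<omega>\<in>C n. X \<omega> \<in> B}|N. 1)"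
      "(LINT \<omega>:{\<omega>\<in>S'. Y \<omega> \<in> B}|M. (1::real)) = (LINT \<omega>:{\<omega>\<in>T'. X \<omega> \<in> B}|N. 1)" for n
      using g_law[OF B] law_rest[OF B] meas_M[OF B] meas_N[OF B]
      by (simp_all add: measure_eq_set_integral[symmetric] N.measure_eq_set_integral[symmetric])
    show "measure M {\<omega>\<in>space M. X' \<omega> \<in> B} = measure N {\<omega>\<in>space N. X \<omega> \<in> B}"
      unfolding measure_eq_set_integral[OF X'B] N.measure_eq_set_integral[OF XB]
      using sum_M[OF B, of "\<lambda>_. 1"] sum_N[OF B, of "\<lambda>_. 1"] eqs by simp
    show "(LINT \<omega>:{\<omega>\<in>space M. X' \<omega> \<in> B}|M. Y \<omega>) = (LINT \<omega>:{\<omega>\<in>space N. X \<omega> \<in> B}|N. Z \<omega>)"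
      using sum_M[OF B integrable_Y] sum_N[OF B Z] g_mean[OF B] mean_C[OF B] mean_rest[OF B] by simp
  qed
qed

section \<open>Dyadic dilation\<close>

text \<open>Dyadic grids are nested: the coarse index is the integer quotient of the fine one by a
  power of 2.\<close>

lemma floor_power2_mult_cong:
  fixes x y :: real
  assumes "\<lfloor>2^n * x\<rfloor> = \<lfloor>2^n * y\<rfloor>" "m \<le> n"
  shows "\<lfloor>2^m * x\<rfloor> = \<lfloor>2^m * y\<rfloor>"
proof -
  have "\<lfloor>2^m * z\<rfloor> = \<lfloor>2^n * z\<rfloor> div 2^(n - m)" for z :: real
  proof -
    have "2^n = 2^(n - m) * (2::real)^m"
      using assms(2) by (simp add: power_add[symmetric])
    then have "2^m * z = 2^n * z / real_of_int (2^(n - m))"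
      by simp
    then show ?thesis
      using floor_divide_real_eq_div[of "2^(n - m)" "2^n * z"] by simp
  qed
  then show ?thesis
    using assms(1) by simp
qed

text \<open>
  The interval \<open>[a x, b x)\<close> is the largest dyadic interval around \<open>x\<close> of length at most 1 on whose
  closure \<open>u\<close> stays below \<open>w\<close> by monotonicity alone; where \<open>u x = w x\<close> it degenerates to a point.
\<close>

lemma exists_dyadic_cells:
  fixes u w :: "real \<Rightarrow> real"
  assumes u: "antimono u" "continuous_on UNIV u" and w: "antimono w" "continuous_on UNIV w"
    and uw: "\<And>x. u x \<le> w x"
  shows "\<exists>a b :: real \<Rightarrow> real. a \<in> borel_measurable borel \<and> b \<in> borel_measurable borel \<and>
    (\<forall>x. x - 1 \<le> a x \<and> a x \<le> x \<and> x \<le> b x \<and> b x \<le> x + 1) \<and>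
    (\<forall>x k. a x < k \<longrightarrow> k < b x \<longrightarrow> a k = a x \<and> b k = b x) \<and>
    (\<forall>x. a x < b x \<longrightarrow> u (a x) < w (b x) \<and> a x \<in> \<rat> \<and> b x \<in> \<rat>) \<and>
    (\<forall>x. a x = b x \<longrightarrow> u x = w x)"
proof -
  \<comment> \<open>By monotonicity this compares the largest value of \<open>u\<close> with the
    smallest value of \<open>w\<close> on the closed level-\<open>n\<close> cell around
    \<open>x\<close>. The least such level gives the largest cell; level 0 has length 1.\<close>
  define P where "P x n \<longleftrightarrow> u (real_of_int \<lfloor>2^n * x\<rfloor> / 2^n) < w ((real_of_int \<lfloor>2^n * x\<rfloor> + 1) / 2^n)" for x :: real and n :: nat
  define G where "G x \<longleftrightarrow> (\<exists>n. P x n)" for x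
  define lev where "lev x = (LEAST n. P x n)" for x
  define a where "a x = (if G x then real_of_int \<lfloor>2^lev x * x\<rfloor> / 2^lev x else x)" for x
  define b where "b x = (if G x then (real_of_int \<lfloor>2^lev x * x\<rfloor> + 1) / 2^lev x else x)" for x
  have [measurable]: "u \<in> borel_measurable borel" "w \<in> borel_measurable borel"
    using u(2) w(2) by (auto intro: borel_measurable_continuous_onI)
  have [measurable]: "Measurable.pred borel (\<lambda>x. P x n)" for n
    unfolding P_def by measurable
  have [measurable]: "Measurable.pred borel G"
    unfolding G_def[abs_def] by measurable
  have [measurable]: "lev \<in> measurable borel (count_space UNIV)"
    unfolding lev_def[abs_def] by measurable
  have [measurable]: "(\<lambda>x. 2^lev x :: real) \<in> borel_measurable borel"
    by (rule measurable_compose[of lev borel "count_space UNIV" "\<lambda>n. 2^n"]) auto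
  have meas: "a \<in> borel_measurable borel" "b \<in> borel_measurable borel"
    unfolding a_def[abs_def] b_def[abs_def] by measurable
  have P_lev: "P x (lev x)" if "G x" for x
    using that unfolding G_def lev_def by (rule LeastI_ex)
  have floor_bounds: "real_of_int \<lfloor>2^n * x\<rfloor> / 2^n \<le> x" "x < (real_of_int \<lfloor>2^n * x\<rfloor> + 1) / 2^n" for x :: real and n
    using floor_correct[of "2^n * x"] by (simp_all add: field_simps)
  have width: "(real_of_int \<lfloor>2^n * x\<rfloor> + 1) / 2^n = real_of_int \<lfloor>2^n * x\<rfloor> / 2^n + (1/2)^n" for x :: real and n
    by (simp add: add_divide_distrib power_divide)
  have small: "(1/2::real)^n \<le> 1" for n
    by (simp add: power_le_one)
  have G_ab: "a x \<le> x \<and> x < b x \<and> b x = a x + (1/2)^lev x" if "G x" for x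
    using floor_bounds[where x=x and n="lev x"] that width[where x=x and n="lev x"] by (auto simp: a_def b_def)
  have ab: "a x \<le> x" "x \<le> b x" "x - 1 \<le> a x" "b x \<le> x + 1" "a x < b x \<longleftrightarrow> G x" for x
  proof -
    have "a x \<le> x \<and> x \<le> b x \<and> x - 1 \<le> a x \<and> b x \<le> x + 1 \<and> (a x < b x \<longleftrightarrow> G x)"
      using G_ab[of x] small[of "lev x"] by (cases "G x") (auto, auto simp: a_def b_def)
    then show "a x \<le> x" "x \<le> b x" "x - 1 \<le> a x" "b x \<le> x + 1" "a x < b x \<longleftrightarrow> G x"
      by auto
  qed
  have cell: "a k = a x \<and> b k = b x" if k: "a x < k" "k < b x" for x k
  proof -
    have Gx: "G x"
      using k ab(5)[of x] by simp
    let ?n = "lev x"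
    have "real_of_int \<lfloor>2^?n * x\<rfloor> \<le> 2^?n * k" "2^?n * k < real_of_int \<lfloor>2^?n * x\<rfloor> + 1"
      using k Gx by (auto simp: a_def b_def field_simps)
    then have eq: "\<lfloor>2^?n * k\<rfloor> = \<lfloor>2^?n * x\<rfloor>"
      by (simp add: floor_eq_iff)
    have P_eq: "P k m = P x m" if "m \<le> ?n" for m
      unfolding P_def using floor_power2_mult_cong[OF eq that] by simp
    \<comment> \<open>Points of one cell of level \<open>?n\<close> share all coarser cells, hence
      the same tests and the same least level.\<close>
    have "lev k = ?n"
      unfolding lev_def[of k]
    proof (rule Least_equality)
      show "P k ?n"
        using P_eq[of ?n] P_lev[OF Gx] by simp
      show "?n \<le> m" if "P k m" for m
      proof (rule ccontr)
        assume "\<not> ?n \<le> m"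
        then have "P x m" "m < ?n"
          using P_eq[of m] that by auto
        then show False
          unfolding lev_def using not_less_Least by blast
      qed
    qed
    moreover have "G k"
      using P_eq[of ?n] P_lev[OF Gx] by (auto simp: G_def)
    ultimately show ?thesis
      using Gx eq by (simp add: a_def b_def)
  qed
  have strict: "u (a x) < w (b x)" if "a x < b x" for x
    using P_lev[of x] that ab(5)[of x] by (simp add: a_def b_def P_def)
  have rat: "a x \<in> \<rat> \<and> b x \<in> \<rat>" if "a x < b x" for x
    using that ab(5)[of x] by (auto simp: a_def b_def intro!: Rats_divide Rats_add)
  \<comment> \<open>When the test fails at every level, \<open>w\<close> at the right end is at most
    \<open>u\<close> at the left end of cells shrinking to \<open>x\<close>, and continuity gives
    the missing inequality.\<close>
  have tight: "u x = w x" if "a x = b x" for x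
  proof (rule antisym[OF uw])
    have nG: "\<not> G x"
      using that ab(5)[of x] by simp
    define l where "l n = real_of_int \<lfloor>2^n * x\<rfloor> / 2^n" for n :: nat
    have l: "l n \<le> x" "x < l n + (1/2)^n" for n
      using floor_bounds[where x=x and n=n] width[where x=x and n=n] by (auto simp: l_def)
    have z: "(\<lambda>n. (1/2::real)^n) \<longlonglongrightarrow> 0"
      by (rule LIMSEQ_realpow_zero) auto
    have lim: "l \<longlonglongrightarrow> x"
    proof (rule tendsto_sandwich)
      have "(\<lambda>n. x - (1/2)^n) \<longlonglongrightarrow> x - 0"
        by (intro tendsto_diff tendsto_const z)
      then show "(\<lambda>n. x - (1/2)^n) \<longlonglongrightarrow> x"
        by simp
      show "\<forall>\<^sub>F n in sequentially. x - (1/2)^n \<le> l n" "\<forall>\<^sub>F n in sequentially. l n \<le> x"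
        using l by (auto simp: diff_le_eq less_imp_le)
    qed (rule tendsto_const)
    have "(\<lambda>n. l n + (1/2)^n) \<longlonglongrightarrow> x + 0"
      by (intro tendsto_add lim z)
    then have "(\<lambda>n. w (l n + (1/2)^n)) \<longlonglongrightarrow> w x"
      using w(2) by (auto simp: continuous_on_eq_continuous_at intro: isCont_tendsto_compose)
    moreover have "(\<lambda>n. u (l n)) \<longlonglongrightarrow> u x"
      using u(2) lim by (auto simp: continuous_on_eq_continuous_at intro: isCont_tendsto_compose)
    moreover have "w (l n + (1/2)^n) \<le> u (l n)" for n
    proof -
      have "w ((real_of_int \<lfloor>2^n * x\<rfloor> + 1) / 2^n) \<le> u (real_of_int \<lfloor>2^n * x\<rfloor> / 2^n)"
        using nG by (auto simp: G_def P_def not_less)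
      then show ?thesis
        by (simp only: width l_def)
    qed
    ultimately show "w x \<le> u x"
      by (intro LIMSEQ_le) auto
  qed
  show ?thesis
    by (intro exI[of _ a] exI[of _ b] conjI allI impI meas ab cell strict tight
        rat[THEN conjunct1] rat[THEN conjunct2] cell[THEN conjunct1] cell[THEN conjunct2])
qed

text \<open>The joint law of a point \<open>x\<close> drawn from \<mu> and a coin that shows
  \<open>True\<close> with probability \<open>r x\<close>. Written as a density against counting
  measure, it turns integrals over the coin into sums of two terms.\<close>

definition two_point_kernel :: "real measure \<Rightarrow> (real \<Rightarrow> real) \<Rightarrow> (real \<times> bool) measure" where
  "two_point_kernel \<mu> r =
     density (\<mu> \<Otimes>\<^sub>M count_space UNIV) (\<lambda>p. ennreal (if snd p then r (fst p) else 1 - r (fst p)))"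

lemma integral_two_point_kernel:
  fixes h :: "real \<times> bool \<Rightarrow> real"
  assumes "finite_measure \<mu>" and r: "r \<in> borel_measurable \<mu>" "\<And>x. 0 \<le> r x" "\<And>x. r x \<le> 1"
    and h [measurable]: "h \<in> borel_measurable (\<mu> \<Otimes>\<^sub>M count_space UNIV)"
    and int: "integrable \<mu> (\<lambda>x. h (x, False))" "integrable \<mu> (\<lambda>x. h (x, True))"
  shows "integrable (two_point_kernel \<mu> r) h"
    and "(\<integral>p. h p \<partial>two_point_kernel \<mu> r) = (\<integral>x. (1 - r x) * h (x, False) + r x * h (x, True) \<partial>\<mu>)"
proof -
  interpret finite_measure \<mu> by fact
  interpret B: sigma_finite_measure "count_space (UNIV :: bool set)"
    by (rule sigma_finite_measure_count_space)
  interpret pair_sigma_finite \<mu> "count_space (UNIV :: bool set)" ..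
  note r(1) [measurable]
  let ?c = "\<lambda>p::real \<times> bool. if snd p then r (fst p) else 1 - r (fst p)"
  have c_meas [measurable]: "?c \<in> borel_measurable (\<mu> \<Otimes>\<^sub>M count_space UNIV)"
    by measurable
  have c_nonneg: "0 \<le> ?c p" for p
    using r by simp
  have sum_bool: "(\<integral>s. f s \<partial>count_space UNIV) = f False + f True" for f :: "bool \<Rightarrow> real"
    by (simp add: lebesgue_integral_count_space_finite UNIV_bool)
  have intF: "integrable \<mu> (\<lambda>x. (1 - r x) * h (x, False))"
  proof (rule Bochner_Integration.integrable_bound[OF int(1)])
    show "AE x in \<mu>. norm ((1 - r x) * h (x, False)) \<le> norm (h (x, False))"
      using r by (auto simp: abs_mult intro!: mult_left_le_one_le)
  qed (use int in simp)
  have intT: "integrable \<mu> (\<lambda>x. r x * h (x, True))"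
  proof (rule Bochner_Integration.integrable_bound[OF int(2)])
    show "AE x in \<mu>. norm (r x * h (x, True)) \<le> norm (h (x, True))"
      using r by (auto simp: abs_mult intro!: mult_left_le_one_le)
  qed (use int in simp)
  have prod: "integrable (\<mu> \<Otimes>\<^sub>M count_space UNIV) (\<lambda>p. ?c p *\<^sub>R h p)"
  proof (rule Fubini_integrable)
    show "integrable \<mu> (\<lambda>x. \<integral>s. norm (?c (x, s) *\<^sub>R h (x, s)) \<partial>count_space UNIV)"
      unfolding sum_bool using intF intT by auto
    show "AE x in \<mu>. integrable (count_space UNIV) (\<lambda>s. ?c (x, s) *\<^sub>R h (x, s))"
      by (intro AE_I2 integrable_count_space) simp
  qed simp
  show "integrable (two_point_kernel \<mu> r) h"
    unfolding two_point_kernel_def using prod c_nonneg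
    by (subst integrable_density) auto
  have "(\<integral>p. h p \<partial>two_point_kernel \<mu> r) = (\<integral>p. ?c p *\<^sub>R h p \<partial>(\<mu> \<Otimes>\<^sub>M count_space UNIV))"
    unfolding two_point_kernel_def using c_nonneg
    by (intro integral_density) auto
  also have "\<dots> = (\<integral>x. \<integral>s. ?c (x, s) *\<^sub>R h (x, s) \<partial>count_space UNIV \<partial>\<mu>)"
    using integral_fst'[OF prod] by simp
  also have "\<dots> = (\<integral>x. (1 - r x) * h (x, False) + r x * h (x, True) \<partial>\<mu>)"
    by (simp add: sum_bool)
  finally show "(\<integral>p. h p \<partial>two_point_kernel \<mu> r) = (\<integral>x. (1 - r x) * h (x, False) + r x * h (x, True) \<partial>\<mu>)" .
qed

text \<open>
  Moving each \<open>x\<close> to the end points of its cell, with mean \<open>x\<close>, replaces the call function of \<open>\<mu>\<close>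
  by its chord on every cell, which still lies below \<open>w\<close>.
\<close>

lemma exists_dyadic_dilation:
  fixes \<mu> :: "real measure" and w :: "real \<Rightarrow> real"
  assumes "prob_space \<mu>" and sets_\<mu>: "sets \<mu> = sets borel" and int: "integrable \<mu> (\<lambda>x. x)"
    and w: "antimono w" "continuous_on UNIV w" and le_w: "\<And>k. call \<mu> (\<lambda>x. x) UNIV k \<le> w k"
  shows "\<exists>(N :: (real \<times> bool) measure) X Z. finite_measure N \<and> X \<in> borel_measurable N \<and> integrable N Z \<and>
    (\<forall>B\<in>sets borel. measure N {p\<in>space N. X p \<in> B} = measure \<mu> B \<and>
      (LINT p:{p\<in>space N. X p \<in> B}|N. Z p) = (LINT x:B|\<mu>. x)) \<and>
    (\<forall>k. call N Z (space N) k \<le> w k) \<and>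
    (\<forall>p\<in>space N. Z p \<notin> \<rat> \<longrightarrow> X p = Z p \<and> call N Z (space N) (Z p) = w (Z p))"
proof -
  interpret prob_space \<mu> by fact
  note sets_\<mu> [measurable_cong]
  have space_\<mu>: "space \<mu> = UNIV"
    using sets_eq_imp_space_eq[OF sets_\<mu>] by simp
  define u where "u = call \<mu> (\<lambda>x. x) UNIV"
  have UNIV_\<mu>: "UNIV \<in> sets \<mu>"
    using sets_\<mu> by simp
  have u: "antimono u" "continuous_on UNIV u"
    unfolding u_def using int UNIV_\<mu> by (auto intro!: antimonoI call_antimono continuous_on_call)
  have "u k \<le> w k" for k
    using le_w by (simp add: u_def)
  from exists_dyadic_cells[OF u w this]
  obtain a b where cells: "a \<in> borel_measurable borel \<and> b \<in> borel_measurable borel \<and>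
    (\<forall>x. x - 1 \<le> a x \<and> a x \<le> x \<and> x \<le> b x \<and> b x \<le> x + 1) \<and>
    (\<forall>x k. a x < k \<longrightarrow> k < b x \<longrightarrow> a k = a x \<and> b k = b x) \<and>
    (\<forall>x. a x < b x \<longrightarrow> u (a x) < w (b x) \<and> a x \<in> \<rat> \<and> b x \<in> \<rat>) \<and>
    (\<forall>x. a x = b x \<longrightarrow> u x = w x)"
    by (elim exE) (rule that)
  note ab_meas = cells[THEN conjunct1] cells[THEN conjunct2, THEN conjunct1]
    and cells' = cells[THEN conjunct2, THEN conjunct2]
  note ab' = cells'[THEN conjunct1] and cell = cells'[THEN conjunct2, THEN conjunct1, rule_format]
    and strict' = cells'[THEN conjunct2, THEN conjunct2, THEN conjunct1]
    and tight = cells'[THEN conjunct2, THEN conjunct2, THEN conjunct2, rule_format]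
  note [measurable] = ab_meas
  have ab: "x - 1 \<le> a x" "a x \<le> x" "x \<le> b x" "b x \<le> x + 1" for x
    using ab' by auto
  have strict: "u (a x) < w (b x)" and rat: "a x \<in> \<rat> \<and> b x \<in> \<rat>" if "a x < b x" for x
    using strict' that by auto
  have ab_le: "a x \<le> b x" for x
    using ab(2,3)[of x] by simp
  \<comment> \<open>on degenerate cells the division by zero puts all mass on the left end point\<close>
  define r where "r x = (x - a x) / (b x - a x)" for x
  have r_meas [measurable]: "r \<in> borel_measurable borel"
    unfolding r_def[abs_def] by measurable
  have r: "0 \<le> r x" "r x \<le> 1" for x
    using ab(2,3)[of x] by (auto simp: r_def divide_le_eq)
  have bary: "(1 - r x) * a x + r x * b x = x" for x
  proof (cases "a x < b x")
    case True
    then have "r x * (b x - a x) = x - a x"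
      by (simp add: r_def)
    then show ?thesis
      by (simp add: algebra_simps)
  next
    case False
    then have "a x = x" "b x = x"
      using ab(2,3)[of x] by auto
    then show ?thesis by (simp add: algebra_simps)
  qed
  define N where "N = two_point_kernel \<mu> r"
  define Z where "Z p = (if snd p then b (fst p) else a (fst p))" for p :: "real \<times> bool"
  have sets_N: "sets N = sets (\<mu> \<Otimes>\<^sub>M count_space UNIV)"
    by (simp add: N_def two_point_kernel_def)
  note sets_N [measurable_cong]
  have space_N: "space N = UNIV"
    using sets_eq_imp_space_eq[OF sets_N] by (simp add: space_pair_measure space_\<mu>)
  have r_\<mu>: "r \<in> borel_measurable \<mu>"
    by measurable
  note kernel = integral_two_point_kernel[OF finite_measure_axioms r_\<mu> r, folded N_def]
  have Z_meas [measurable]: "Z \<in> borel_measurable (\<mu> \<Otimes>\<^sub>M count_space UNIV)"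
    unfolding Z_def[abs_def] by measurable
  \<comment> \<open>The end points stay within distance 1 of \<open>x\<close>; this is the use of
    bounding the cell length, and it gives \<open>Z\<close> a finite mean.\<close>
  have int_ab: "integrable \<mu> a" "integrable \<mu> b"
  proof -
    have bound: "integrable \<mu> (\<lambda>x. \<bar>x\<bar> + 1)"
      using int by simp
    have "norm (a x) \<le> norm (\<bar>x\<bar> + 1)" "norm (b x) \<le> norm (\<bar>x\<bar> + 1)" for x
      using ab[of x] unfolding real_norm_def by linarith+
    then show "integrable \<mu> a" "integrable \<mu> b"
      by (auto intro!: Bochner_Integration.integrable_bound[OF bound] AE_I2)
  qed
  have Z_int: "integrable N Z"
    using int_ab by (intro kernel(1)) (simp_all add: Z_def)
  have N_fin: "finite_measure N"
  proof (rule finite_measureI)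
    have "integrable N (\<lambda>_. 1::real)"
      by (intro kernel(1)) simp_all
    then show "emeasure N (space N) \<noteq> \<infinity>"
      by (simp add: integrable_iff_bounded)
  qed
  interpret N: finite_measure N by fact
  have cyl [measurable]: "{p\<in>space N. fst p \<in> B} \<in> sets N" if [measurable]: "B \<in> sets borel" for B
    by measurable
  have law: "measure N {p\<in>space N. fst p \<in> B} = measure \<mu> B" if B [measurable]: "B \<in> sets borel" for B
  proof -
    have "measure N {p\<in>space N. fst p \<in> B} = (\<integral>p. indicator {p\<in>space N. fst p \<in> B} p \<partial>N)"
      by (simp add: space_N)
    also have "\<dots> = (\<integral>p. indicator B (fst p) \<partial>N)"
      by (intro Bochner_Integration.integral_cong) (auto simp: indicator_def space_N)
    also have "\<dots> = (\<integral>x. (1 - r x) * indicator B x + r x * indicator B x \<partial>\<mu>)"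
      using B sets_\<mu> by (subst kernel(2)) (simp_all add: integrable_indicator_iff emeasure_eq_measure)
    also have "\<dots> = measure \<mu> B"
      using B sets_\<mu> by (simp add: algebra_simps space_\<mu>)
    finally show ?thesis .
  qed
  have mean: "(LINT p:{p\<in>space N. fst p \<in> B}|N. Z p) = (LINT x:B|\<mu>. x)" if B [measurable]: "B \<in> sets borel" for B
  proof -
    have ind: "integrable \<mu> (\<lambda>x. indicator B x * f x)" if "integrable \<mu> f" for f :: "real \<Rightarrow> real"
      using integrable_mult_indicator[OF _ that, of B] B sets_\<mu> by simp
    have "(LINT p:{p\<in>space N. fst p \<in> B}|N. Z p) = (\<integral>p. indicator B (fst p) * Z p \<partial>N)"
      unfolding set_lebesgue_integral_def
      by (intro Bochner_Integration.integral_cong) (auto simp: indicator_def space_N)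
    also have "\<dots> = (\<integral>x. (1 - r x) * (indicator B x * a x) + r x * (indicator B x * b x) \<partial>\<mu>)"
      using ind int_ab by (subst kernel(2)) (simp_all add: Z_def)
    also have "\<dots> = (\<integral>x. indicator B x * ((1 - r x) * a x + r x * b x) \<partial>\<mu>)"
      by (simp add: algebra_simps)
    finally show ?thesis
      by (simp add: bary set_lebesgue_integral_def)
  qed
  \<comment> \<open>The conditional expectation of the call payoff of \<open>Z\<close> given the
    base point \<open>x\<close>.\<close>
  define chord where "chord k x = (1 - r x) * max 0 (a x - k) + r x * max 0 (b x - k)" for k x
  have call_N: "call N Z (space N) k = (\<integral>x. chord k x \<partial>\<mu>)" for k
  proof -
    have "call N Z (space N) k = (\<integral>p. max 0 (Z p - k) \<partial>N)"
      unfolding call_def using Z_int by (intro set_integral_space) auto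
    also have "\<dots> = (\<integral>x. chord k x \<partial>\<mu>)"
      using int_ab by (subst kernel(2)) (auto simp: Z_def chord_def[abs_def])
    finally show ?thesis .
  qed
  have chord_int: "integrable \<mu> (chord k)" for k
  proof (rule Bochner_Integration.integrable_bound)
    show "integrable \<mu> (\<lambda>x. max 0 (a x - k) + max 0 (b x - k))"
      using int_ab by auto
    show "AE x in \<mu>. norm (chord k x) \<le> norm (max 0 (a x - k) + max 0 (b x - k))"
    proof (rule AE_I2)
      fix x
      have "chord k x \<le> max 0 (a x - k) + max 0 (b x - k)"
        unfolding chord_def using r[of x] by (intro add_mono mult_left_le_one_le) auto
      moreover have "0 \<le> chord k x"
        unfolding chord_def using r[of x] by simp
      ultimately show "norm (chord k x) \<le> norm (max 0 (a x - k) + max 0 (b x - k))"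
        by simp
    qed
    show "chord k \<in> borel_measurable \<mu>"
      unfolding chord_def[abs_def] by measurable
  qed
  have u_int: "u k = (\<integral>x. max 0 (x - k) \<partial>\<mu>)" for k
    unfolding u_def call_def using int set_integral_space[of \<mu> "\<lambda>x. max 0 (x - k)"] by (simp add: space_\<mu>)
  \<comment> \<open>The only kink of the payoff is at \<open>k\<close>. On a cell without
    \<open>k\<close> in its interior the payoff is affine, so by \<open>bary\<close> spreading the
    mass does not change its mean.\<close>
  have chord_outside: "chord k x = max 0 (x - k)" if "\<not> (a x < k \<and> k < b x)" for k x
  proof (cases "k \<le> a x")
    case True
    then have "chord k x = ((1 - r x) * a x + r x * b x) - k"
      using ab(2)[of x] ab_le[of x] by (simp add: chord_def algebra_simps)
    then show ?thesis
      using True ab(2)[of x] by (simp add: bary)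
  next
    case False
    then have "b x \<le> k"
      using that by simp
    then show ?thesis
      using ab(3)[of x] ab_le[of x] by (simp add: chord_def)
  qed
  \<comment> \<open>If the cell of \<open>k\<close> is degenerate, no cell has \<open>k\<close> in
    its interior: the call at \<open>k\<close> is unchanged, and \<open>tight\<close>
    applies.\<close>
  have call_eq: "call N Z (space N) k = w k" if "a k = b k" for k
  proof -
    have "chord k x = max 0 (x - k)" for x
      using that cell[of x k] by (intro chord_outside) auto
    then show ?thesis
      using tight[OF that] by (simp add: call_N u_int)
  qed
  have call_le: "call N Z (space N) k \<le> w k" for k
  proof (cases "a k = b k")
    case False
    then have k: "a k < b k"
      using ab_le[of k] by simp
    \<comment> \<open>Spreading raises the call at \<open>k\<close> at most to
      \<open>u (a k)\<close>, the original call at the left end, which the choice of the cell keeps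
      below \<open>w (b k)\<close>.\<close>
    have "chord k x \<le> max 0 (x - a k)" for x
    proof (cases "a x < k \<and> k < b x")
      case True
      then have eq: "a k = a x" "b k = b x"
        using cell[of x k] by blast+
      have "chord k x = r x * (b x - k)"
        using True by (simp add: chord_def)
      also have "\<dots> \<le> r x * (b x - a x)"
        using True r[of x] by (intro mult_left_mono) auto
      also have "\<dots> = x - a x"
        using True by (simp add: r_def)
      finally show ?thesis
        by (simp add: eq)
    next
      case False
      then show ?thesis
        using ab(2)[of k] by (simp add: chord_outside)
    qed
    then have "call N Z (space N) k \<le> u (a k)"
      unfolding call_N u_int using chord_int int by (intro integral_mono) auto
    also have "\<dots> \<le> w (b k)"
      using strict[OF k] by simp
    also have "\<dots> \<le> w k"
      using w(1) ab(3) by (rule antimonoD)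
    finally show ?thesis .
  qed (simp add: call_eq)
  \<comment> \<open>Nondegenerate cells have rational end points, so an irrational
    \<open>Z p\<close> comes from a point that was not moved.\<close>
  have irrational: "fst p = Z p \<and> call N Z (space N) (Z p) = w (Z p)" if "Z p \<notin> \<rat>" for p
  proof -
    have "\<not> a (fst p) < b (fst p)"
      using rat[of "fst p"] that by (cases "snd p") (auto simp: Z_def)
    then have "a (fst p) = fst p" "b (fst p) = fst p"
      using ab(2,3)[of "fst p"] by auto
    then show ?thesis
      using call_eq[of "fst p"] by (simp add: Z_def)
  qed
  have fst_meas: "fst \<in> borel_measurable N"
    by measurable
  show ?thesis
    by (intro exI[of _ N] exI[of _ fst] exI[of _ Z] conjI ballI allI impI N_fin fst_meas Z_int law mean call_le
        irrational[THEN conjunct1] irrational[THEN conjunct2])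
qed

section \<open>From convex order of laws to conditional expectation\<close>

lemma convex_on_call: "convex_on UNIV (\<lambda>x::real. max 0 (x - k))"
proof (rule convex_onI)
  fix t x y :: real assume t: "0 < t" "t < 1"
  have "(1 - t) * x + t * y - k = (1 - t) * (x - k) + t * (y - k)"
    by (simp add: algebra_simps)
  also have "\<dots> \<le> (1 - t) * max 0 (x - k) + t * max 0 (y - k)"
    using t by (intro add_mono mult_left_mono) auto
  finally have le: "(1 - t) * x + t * y - k \<le> (1 - t) * max 0 (x - k) + t * max 0 (y - k)" .
  have "0 \<le> (1 - t) * max 0 (x - k) + t * max 0 (y - k)"
    using t by (intro add_nonneg_nonneg mult_nonneg_nonneg) auto
  with le show "max 0 ((1 - t) *\<^sub>R x + t *\<^sub>R y - k) \<le> (1 - t) * max 0 (x - k) + t * max 0 (y - k)"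
    unfolding real_scaleR_def by (rule max.boundedI[rotated])
qed (rule convex_UNIV)

lemma convex_order_integral_le:
  assumes "convex_order \<mu> \<nu>" "convex_on UNIV \<phi>" "integrable \<mu> \<phi>" "integrable \<nu> \<phi>"
  shows "integral\<^sup>L \<mu> \<phi> \<le> integral\<^sup>L \<nu> \<phi>"
proof -
  have "ext_integral \<mu> \<phi> \<le> ext_integral \<nu> \<phi>"
    using assms(1,2) unfolding convex_order_def by blast
  then show ?thesis
    using assms(3,4) by (simp add: ext_integral_eq_integral)
qed

text \<open>The generated sigma-algebra consists of the preimages under \<open>X\<close>, so
  \<open>eq\<close> is the averaging property that characterises the conditional
  expectation.\<close>

lemma AE_eq_cond_exp_given:
  assumes "prob_space M" and X [measurable]: "X \<in> borel_measurable M" and int: "integrable M X" "integrable M Y"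
    and eq: "\<And>B. B \<in> sets borel \<Longrightarrow>
      (LINT \<omega>:{\<omega>\<in>space M. X \<omega> \<in> B}|M. Y \<omega>) = (LINT \<omega>:{\<omega>\<in>space M. X \<omega> \<in> B}|M. X \<omega>)"
  shows "AE \<omega> in M. X \<omega> = cond_exp_given M Y X \<omega>"
proof -
  interpret prob_space M by fact
  let ?F = "vimage_algebra (space M) X borel"
  have "subalgebra M ?F"
    unfolding subalgebra_def using X
    by (auto simp: sets_vimage_algebra2 measurable_sets)
  then interpret finite_measure_subalgebra M ?F
    by (intro finite_measure_subalgebra.intro finite_measure_subalgebra_axioms.intro finite_measure_axioms)
  have "AE \<omega> in M. real_cond_exp M ?F Y \<omega> = X \<omega>"
  proof (rule real_cond_exp_charact)
    fix A assume "A \<in> sets ?F"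
    then obtain B where B: "B \<in> sets borel" "A = X -` B \<inter> space M"
      by (auto simp: sets_vimage_algebra2)
    have "A = {\<omega>\<in>space M. X \<omega> \<in> B}"
      using B by auto
    then show "(LINT \<omega>:A|M. Y \<omega>) = (LINT \<omega>:A|M. X \<omega>)"
      using eq[OF B(1)] by simp
  next
    show "X \<in> borel_measurable ?F"
      by (rule measurable_vimage_algebra1) simp
  qed (rule int)+
  then show ?thesis
    unfolding cond_exp_given_def by eventually_elim simp
qed

theorem theorem3p1:
  fixes M :: "'a measure" and X Y :: "'a \<Rightarrow> real"
  assumes "prob_space M" and "atomless M"
    and "X \<in> borel_measurable M" and "Y \<in> borel_measurable M"
    and "convex_order (distr M borel X) (distr M borel Y)"
  shows "\<exists>X' :: 'a \<Rightarrow> real. X' \<in> borel_measurable M \<and>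
           distr M borel X' = distr M borel X \<and>
           (AE \<omega> in M. X' \<omega> = cond_exp_given M Y X' \<omega>)"
proof -
  interpret prob_space M by fact
  note [measurable] = assms(3,4)
  define \<mu> where "\<mu> = distr M borel X"
  define \<nu> where "\<nu> = distr M borel Y"
  have order: "convex_order \<mu> \<nu>"
    unfolding \<mu>_def \<nu>_def by fact
  then have "borel_prob_finite_mean \<mu>" "borel_prob_finite_mean \<nu>"
    unfolding convex_order_def by blast+
  then have \<mu>: "prob_space \<mu>" "sets \<mu> = sets borel" "integrable \<mu> (\<lambda>x. x)"
    and \<nu>: "prob_space \<nu>" "integrable \<nu> (\<lambda>x. x)"
    by (simp_all add: borel_prob_finite_mean_def)
  interpret \<mu>: prob_space \<mu> by fact
  interpret \<nu>: prob_space \<nu> by fact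
  have Y: "integrable M Y"
    using \<nu>(2) unfolding \<nu>_def by (subst (asm) integrable_distr_eq) auto
  have le: "integral\<^sup>L \<mu> \<phi> \<le> (\<integral>\<omega>. \<phi> (Y \<omega>) \<partial>M)"
    if "convex_on UNIV \<phi>" "integrable \<mu> \<phi>" "integrable \<nu> \<phi>" "\<phi> \<in> borel_measurable borel" for \<phi> :: "real \<Rightarrow> real"
  proof -
    have "integral\<^sup>L \<nu> \<phi> = (\<integral>\<omega>. \<phi> (Y \<omega>) \<partial>M)"
      unfolding \<nu>_def using that(4) by (intro integral_distr) auto
    then show ?thesis
      using convex_order_integral_le[OF order that(1-3)] by (simp only:)
  qed
  have space_\<mu>: "space \<mu> = UNIV"
    by (simp add: \<mu>_def)
  have mean: "(\<integral>x. x \<partial>\<mu>) = (\<integral>\<omega>. Y \<omega> \<partial>M)"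
  proof (rule antisym)
    \<comment> \<open>The identity and its negative are both convex, which forces equal
      means.\<close>
    have id: "convex_on UNIV (\<lambda>x::real. x)" "convex_on UNIV (\<lambda>x::real. - x)"
      by (simp_all add: convex_on_def algebra_simps)
    show "(\<integral>x. x \<partial>\<mu>) \<le> (\<integral>\<omega>. Y \<omega> \<partial>M)"
      by (rule le[OF id(1) \<mu>(3) \<nu>(2)]) simp
    have "integrable \<mu> (\<lambda>x. - x)" "integrable \<nu> (\<lambda>x. - x)"
      using \<mu>(3) \<nu>(2) by simp_all
    then have "(\<integral>x. - x \<partial>\<mu>) \<le> (\<integral>\<omega>. - Y \<omega> \<partial>M)"
      by (rule le[OF id(2)]) simp
    then show "(\<integral>\<omega>. Y \<omega> \<partial>M) \<le> (\<integral>x. x \<partial>\<mu>)"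
      by simp
  qed
  define w where "w = call M Y (space M)"
  have call_le: "call \<mu> (\<lambda>x. x) UNIV k \<le> w k" for k
  proof -
    have "(\<integral>x. max 0 (x - k) \<partial>\<mu>) \<le> (\<integral>\<omega>. max 0 (Y \<omega> - k) \<partial>M)"
    proof (rule le[OF convex_on_call])
      show "integrable \<mu> (\<lambda>x. max 0 (x - k))" "integrable \<nu> (\<lambda>x. max 0 (x - k))"
        using \<mu>(3) \<nu>(2) by auto
    qed simp
    then show ?thesis
      using \<mu>(3) Y set_integral_space[of \<mu> "\<lambda>x. max 0 (x - k)"] set_integral_space[of M "\<lambda>\<omega>. max 0 (Y \<omega> - k)"]
      by (simp add: w_def call_def space_\<mu>)
  qed
  have w: "antimono w" "continuous_on UNIV w"
    unfolding w_def using Y by (auto intro!: antimonoI call_antimono continuous_on_call)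
  obtain N :: "(real \<times> bool) measure" and X0 Z where N: "finite_measure N" "X0 \<in> borel_measurable N" "integrable N Z"
    and law: "\<forall>B\<in>sets borel. measure N {p\<in>space N. X0 p \<in> B} = measure \<mu> B \<and>
      (LINT p:{p\<in>space N. X0 p \<in> B}|N. Z p) = (LINT x:B|\<mu>. x)"
    and call_N: "\<forall>k. call N Z (space N) k \<le> w k"
    and irrational: "\<forall>p\<in>space N. Z p \<notin> \<rat> \<longrightarrow> X0 p = Z p \<and> call N Z (space N) (Z p) = w (Z p)"
    using exists_dyadic_dilation[OF \<mu> w call_le] by (elim exE conjE) (rule that)
  obtain R where "ranked M Y R"
    using exists_ranked[OF assms(2) Y] .
  then interpret ranked M Y R .
  have "measure N (space N) = 1"
    using law[rule_format, of UNIV] \<mu>.prob_space by (simp add: space_\<mu>)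
  moreover have "(LINT p:space N|N. Z p) = (LINT \<omega>:space M|M. Y \<omega>)"
    using law[rule_format, of UNIV] mean Y \<mu>(3) set_integral_space[of M Y] set_integral_space[of \<mu> "\<lambda>x. x"]
    by (simp add: space_\<mu>)
  ultimately have dom: "dominates M Y (space M) N Z (space N)"
    using call_N by (simp add: dominates_def prob_space w_def)
  have "\<exists>X'\<in>borel_measurable M. \<forall>B\<in>sets borel.
    measure M {\<omega>\<in>space M. X' \<omega> \<in> B} = measure N {p\<in>space N. X0 p \<in> B} \<and>
    (LINT \<omega>:{\<omega>\<in>space M. X' \<omega> \<in> B}|M. Y \<omega>) = (LINT p:{p\<in>space N. X0 p \<in> B}|N. Z p)"
    by (rule exists_martingale_projection[OF assms(2) N dom irrational[rule_format, unfolded w_def]])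
  then obtain X' where X' [measurable]: "X' \<in> borel_measurable M"
    and X'_law: "\<forall>B\<in>sets borel. measure M {\<omega>\<in>space M. X' \<omega> \<in> B} = measure N {p\<in>space N. X0 p \<in> B} \<and>
      (LINT \<omega>:{\<omega>\<in>space M. X' \<omega> \<in> B}|M. Y \<omega>) = (LINT p:{p\<in>space N. X0 p \<in> B}|N. Z p)"
    by (elim bexE) (rule that)
  have distr: "distr M borel X' = \<mu>"
  proof (rule measure_eqI)
    fix B assume "B \<in> sets (distr M borel X')"
    then have B: "B \<in> sets borel" by simp
    have "emeasure (distr M borel X') B = measure M {\<omega>\<in>space M. X' \<omega> \<in> B}"
      using B by (subst emeasure_distr) (auto simp: emeasure_eq_measure intro!: arg_cong[where f="measure M"])
    then show "emeasure (distr M borel X') B = emeasure \<mu> B"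
      using X'_law law B by (simp add: \<mu>.emeasure_eq_measure)
  qed (simp add: \<mu>(2))
  have X'_int: "integrable M X'"
    using \<mu>(3) unfolding distr[symmetric] by (simp add: integrable_distr_eq)
  have "AE \<omega> in M. X' \<omega> = cond_exp_given M Y X' \<omega>"
  proof (rule AE_eq_cond_exp_given[OF assms(1) X' X'_int Y])
    fix B :: "real set" assume B [measurable]: "B \<in> sets borel"
    have "(LINT \<omega>:{\<omega>\<in>space M. X' \<omega> \<in> B}|M. Y \<omega>) = (LINT x:B|distr M borel X'. x)"
      using X'_law law B by (simp add: distr)
    also have "\<dots> = (\<integral>\<omega>. indicator B (X' \<omega>) *\<^sub>R X' \<omega> \<partial>M)"
      unfolding set_lebesgue_integral_def by (intro integral_distr) auto
    also have "\<dots> = (LINT \<omega>:{\<omega>\<in>space M. X' \<omega> \<in> B}|M. X' \<omega>)"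
      unfolding set_lebesgue_integral_def
      by (intro Bochner_Integration.integral_cong) (auto simp: indicator_def)
    finally show "(LINT \<omega>:{\<omega>\<in>space M. X' \<omega> \<in> B}|M. Y \<omega>) = (LINT \<omega>:{\<omega>\<in>space M. X' \<omega> \<in> B}|M. X' \<omega>)" .
  qed
  then show ?thesis
    using X' distr unfolding \<mu>_def by blast
qed

end
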